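(* Suppose that $R$ is a discrete valuation ring with maximal ideal $\pi$ and residue field $k=R/\pi$, and that the cellular $R$-algebra $A_R$ has a family of JM-elements which separate $T(\Lambda)$ over $R$. Then: (a) $\{g^\lambda_{\mathfrak s\mathfrak t}:\mathfrak s,\mathfrak t\in T(\lambda),\ \lambda\in\Lambda\}$ is a cellular basis of $A_k$. (b) Let $\Gamma$ be a residue linkage class of $\Lambda$. Then $A_k^\Gamma$ is a cellular algebra with cellular basis $\{g^\lambda_{\mathfrak s\mathfrak t}:\mathfrak s,\mathfrak t\in T(\lambda),\ \lambda\in\Gamma\}$. (c) The residue linkage classes decompose $A_k$ into a direct sum of cellular subalgebras: $A_k=\bigoplus_{\Gamma\in\Lambda/\sim}A_k^\Gamma$.
   Context: Let $R$ be a discrete valuation ring with maximal ideal $\pi$, field of fractions $K$ and residue field $k=R/\pi$, and let $A=A_R$ be a unital $R$-algebra. A cell datum for $A$ is a triple $(\Lambda,T,C)$ where $\Lambda=(\Lambda,>)$ is a finite poset, $T(\lambda)$ is a finite set for each $\lambda\in\Lambda$, and $C:\coprod_{\lambda\in\Lambda}T(\lambda)\times T(\lambda)\to A$, $(\mathfrak s,\mathfrak t)\mapsto a^\lambda_{\mathfrak s\mathfrak t}$, is an injective map such that: (i) $\{a^\lambda_{\mathfrak s\mathfrak t}\}$ is an $R$-free basis of $A$; (ii) for any $x\in A$ and $\mathfrak t\in T(\lambda)$ there exist $r_{\mathfrak t\mathfrak v x}\in R$ such that, for all $\mathfrak s\in T(\lambda)$, $a^\lambda_{\mathfrak s\mathfrak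 t}x\equiv\sum_{\mathfrak v\in T(\lambda)}r_{\mathfrak t\mathfrak v x}a^\lambda_{\mathfrak s\mathfrak v}\pmod{A^\lambda}$, where $A^\lambda$ is the $R$-submodule with basis $\{a^\mu_{\mathfrak y\mathfrak z}:\mu>\lambda,\ \mathfrak y,\mathfrak z\in T(\mu)\}$; (iii) the $R$-linear map $*:A\to A$ with $(a^\lambda_{\mathfrak s\mathfrak t})^*=a^\lambda_{\mathfrak t\mathfrak s}$ is an anti-isomorphism of $A$. Then $A$ is called cellular and $\{a^\lambda_{\mathfrak s\mathfrak t}\}$ a cellular basis (the same definition is used over any commutative ring in place of $R$). Each $T(\lambda)$ carries a partial order $\triangleright_\lambda$. Put $T(\Lambda)=\coprod_\lambda T(\lambda)$, ordered by: $\mathfrak s\triangleright\mathfrak t$ if either $\mathfrak s,\mathfrak t\in T(\lambda)$ for some $\lambda$ and $\mathfrak s\triangleright_\lambda\mathfrak t$, or $\mathfrak s\in T(\lambda)$, $\mathfrak t\in T(\mu)$ and $\lambda>\mu$. A family of JM-elements for $A$ is a set $\{L_1,\dots,L_M\}$ of commuting elements of $A$ with $L_i^*=L_i$, together with scalars $c_{\mathfrak t}(i)\in R$ ($\mathfrak t\in T(\Lambda)$, $1\le i\le M$), such that for all $i$, $\lambda\in\Lambda$ and $\mathfrak s,\mathfrak t\in T(\lambda)$ we have $a^\lambda_{\mathfrak s\mathfrak t}L_i\equiv c_{\mathfrak t}(i)a^\lambda_{\mathfrak s\mathfrak t}+\sum_{\mathfrak v\in T(\lambda),\,\mathfrak v\triangleright\mathfrak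 t}r_{\mathfrak t\mathfrak v}a^\lambda_{\mathfrak s\mathfrak v}\pmod{A^\lambda}$ for some $r_{\mathfrak t\mathfrak v}\in R$ (depending on $i$). They separate $T(\Lambda)$ over $R$ if whenever $\mathfrak s\ne\mathfrak t$ in $T(\Lambda)$ there is $i$ with $c_{\mathfrak s}(i)\ne c_{\mathfrak t}(i)$. Let $A_K=A\otimes_RK$ and $A_k=A\otimes_Rk$, cellular with the images of the basis $\{a^\lambda_{\mathfrak s\mathfrak t}\}$ (same notation). A bar denotes reduction modulo $\pi$, both $R\to k$ and $A_R\to A_k$. Let $\mathscr C(i)=\{c_{\mathfrak t}(i):\mathfrak t\in T(\Lambda)\}$. It is assumed that $c-c'$ is invertible in $R$ whenever $c,c'\in\bigcup_i\mathscr C(i)$ and $\bar c\ne\bar c'$ (automatic, since $R$ is local). Put $F_{\mathfrak t}=\prod_{i=1}^M\prod_{c\in\mathscr C(i),\,c\ne c_{\mathfrak t}(i)}\frac{L_i-c}{c_{\mathfrak t}(i)-c}\in A_K$. Residues: $r_{\mathfrak t}(i)=\overline{c_{\mathfrak t}(i)}\in k$. For $\mathfrak s,\mathfrak t\in T(\Lambda)$ write $\mathfrak s\approx\mathfrak t$ (same residue class) if $r_{\mathfrak s}(i)=r_{\mathfrak t}(i)$ for $1\le i\le M$; let $\mathbb T_{\mathfrak s}$ be the residue class of $\mathfrak s$. For $\lambda,\mu\in\Lambda$ write $\lambda\sim\mu$ if there exist $\lambda_0=\lambda,\lambda_1,\dots,\lambda_r=\mu$ in $\Lambda$ and $\mathfrak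 s_j,\mathfrak t_j\in T(\lambda_j)$ with $\mathfrak s_{j-1}\approx\mathfrak t_j$ for $j=1,\dots,r$; the equivalence classes of $\sim$ are the residue linkage classes. For a residue class $\mathbb T$ the element $F_{\mathbb T}=\sum_{\mathfrak t\in\mathbb T}F_{\mathfrak t}$ of $A_K$ lies in $A_R$; let $G_{\mathbb T}=\overline{F_{\mathbb T}}\in A_k$. For $\mathfrak s,\mathfrak t\in T(\lambda)$ let $g^\lambda_{\mathfrak s\mathfrak t}=G_{\mathbb T_{\mathfrak s}}a^\lambda_{\mathfrak s\mathfrak t}G_{\mathbb T_{\mathfrak t}}\in A_k$. For a residue linkage class $\Gamma$ let $A_k^\Gamma$ be the $k$-span of $\{g^\lambda_{\mathfrak s\mathfrak t}:\mathfrak s,\mathfrak t\in T(\lambda),\ \lambda\in\Gamma\}$. *)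

theory Defs
  imports
    Complex_Main
    "HOL-Computational_Algebra.Fraction_Field"
    "HOL-Library.Poly_Mapping"
    "HOL-Library.FuncSet"
begin

section \<open>Discrete valuation rings and their residue fields\<close>

context comm_ring_1
begin

definition ring_ideal :: "'a set \<Rightarrow> bool" where
  "ring_ideal I \<longleftrightarrow> 0 \<in> I \<and> (\<forall>x\<in>I. \<forall>y\<in>I. x + y \<in> I) \<and> (\<forall>r. \<forall>x\<in>I. r * x \<in> I)"

definition ring_maximal_ideal :: "'a set \<Rightarrow> bool" where
  "ring_maximal_ideal M \<longleftrightarrow>
     ring_ideal M \<and> M \<noteq> UNIV \<and> (\<forall>J. ring_ideal J \<longrightarrow> M \<subseteq> J \<longrightarrow> J = M \<or> J = UNIV)"

end

text \<open>A discrete valuation ring is a local principal ideal domain that is not a field.\<close>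

class dvr = idom +
  assumes dvr_principal: "ring_ideal I \<Longrightarrow> \<exists>a. I = range ((*) a)"
    and dvr_local: "\<exists>!M. ring_maximal_ideal M"
    and dvr_not_field: "\<exists>a. a \<noteq> 0 \<and> \<not> a dvd 1"
begin

definition max_ideal :: "'a set" where
  "max_ideal = (THE M. ring_maximal_ideal M)"

lemma max_ideal: "ring_maximal_ideal max_ideal"
  unfolding max_ideal_def by (rule theI'[OF dvr_local])

lemma max_ideal_closed:
  shows "0 \<in> max_ideal"
    and "x \<in> max_ideal \<Longrightarrow> y \<in> max_ideal \<Longrightarrow> x + y \<in> max_ideal"
    and "x \<in> max_ideal \<Longrightarrow> r * x \<in> max_ideal"
    and "x \<in> max_ideal \<Longrightarrow> - x \<in> max_ideal"
    and "1 \<notin> max_ideal"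
proof -
  have I: "ring_ideal max_ideal" and ne: "max_ideal \<noteq> UNIV"
    using max_ideal by (auto simp: ring_maximal_ideal_def)
  show "0 \<in> max_ideal"
    and "x \<in> max_ideal \<Longrightarrow> y \<in> max_ideal \<Longrightarrow> x + y \<in> max_ideal"
    and m: "x \<in> max_ideal \<Longrightarrow> r * x \<in> max_ideal" for x y r
    using I by (auto simp: ring_ideal_def)
  show "x \<in> max_ideal \<Longrightarrow> - x \<in> max_ideal"
    using m[of x "- 1"] by simp
  show "1 \<notin> max_ideal"
  proof
    assume "1 \<in> max_ideal"
    then have "r \<in> max_ideal" for r
      using m[of 1 r] by simp
    with ne show False by auto
  qed
qed

lemma max_ideal_inverse:
  assumes "x \<notin> max_ideal"
  shows "\<exists>y. x * y - 1 \<in> max_ideal"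
proof -
  define J where "J = {m + x * y |m y. m \<in> max_ideal}"
  have "ring_ideal J"
    unfolding ring_ideal_def
  proof (intro conjI allI ballI)
    show "0 \<in> J"
      unfolding J_def using max_ideal_closed(1)
      by (intro CollectI exI[of _ 0] conjI) simp_all
  next
    fix u v assume "u \<in> J" "v \<in> J"
    then obtain m y n z where mn: "m \<in> max_ideal" "n \<in> max_ideal"
      and uv: "u = m + x * y" "v = n + x * z"
      by (auto simp: J_def)
    have "u + v = (m + n) + x * (y + z)"
      using uv by (simp add: algebra_simps)
    then show "u + v \<in> J"
      unfolding J_def using max_ideal_closed(2)[OF mn] by blast
  next
    fix r u assume "u \<in> J"
    then obtain m y where m: "m \<in> max_ideal" and u: "u = m + x * y"
      by (auto simp: J_def)
    have "r * u = r * m + x * (r * y)"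
      using u by (simp add: algebra_simps)
    then show "r * u \<in> J"
      unfolding J_def using max_ideal_closed(3)[OF m] by blast
  qed
  moreover have "max_ideal \<subseteq> J"
  proof
    fix m assume "m \<in> max_ideal"
    moreover have "m = m + x * 0" by simp
    ultimately show "m \<in> J" unfolding J_def by blast
  qed
  moreover have "x \<in> J"
  proof -
    have "x = 0 + x * 1" by simp
    then show ?thesis unfolding J_def using max_ideal_closed(1) by blast
  qed
  ultimately have "J = UNIV"
    using max_ideal assms unfolding ring_maximal_ideal_def by blast
  then obtain m y where m: "m \<in> max_ideal" and 1: "1 = m + x * y"
    unfolding J_def by blast
  have "x * y - 1 = - m"
    using 1 by (simp add: algebra_simps)
  then show ?thesis
    using max_ideal_closed(4)[OF m] by metis
qed

definition residue_rel :: "'a \<Rightarrow> 'a \<Rightarrow> bool" where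
  "residue_rel x y \<longleftrightarrow> x - y \<in> max_ideal"

lemma equivp_residue_rel: "equivp residue_rel"
proof (rule equivpI)
  show "reflp residue_rel"
    by (rule reflpI) (simp add: residue_rel_def max_ideal_closed)
  show "symp residue_rel"
  proof (rule sympI)
    fix x y assume "residue_rel x y"
    then show "residue_rel y x"
      unfolding residue_rel_def using max_ideal_closed(4)[of "x - y"] by simp
  qed
  show "transp residue_rel"
  proof (rule transpI)
    fix x y z assume "residue_rel x y" "residue_rel y z"
    then show "residue_rel x z"
      unfolding residue_rel_def using max_ideal_closed(2)[of "x - y" "y - z"]
    by (simp add: algebra_simps)
  qed
qed

end

quotient_type (overloaded) 'a residue_field = "'a :: dvr" / residue_rel
  by (rule equivp_residue_rel)

lift_definition residue :: "'a::dvr \<Rightarrow> 'a residue_field" is "\<lambda>x. x" .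

instantiation residue_field :: (dvr) comm_ring_1
begin

lift_definition zero_residue_field :: "'a residue_field" is 0 .
lift_definition one_residue_field :: "'a residue_field" is 1 .

lift_definition plus_residue_field :: "'a residue_field \<Rightarrow> 'a residue_field \<Rightarrow> 'a residue_field"
  is "(+)"
proof -
  fix x y z w :: 'a
  assume "residue_rel x y" "residue_rel z w"
  then show "residue_rel (x + z) (y + w)"
    unfolding residue_rel_def using max_ideal_closed(2)[of "x - y" "z - w"]
    by (simp add: algebra_simps)
qed

lift_definition uminus_residue_field :: "'a residue_field \<Rightarrow> 'a residue_field" is uminus
proof -
  fix x y :: 'a
  assume "residue_rel x y"
  then show "residue_rel (- x) (- y)"
    unfolding residue_rel_def using max_ideal_closed(4)[of "x - y"] by simp
qed

lift_definition minus_residue_field :: "'a residue_field \<Rightarrow> 'a residue_field \<Rightarrow> 'a residue_field"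
  is minus
proof -
  fix x y z w :: 'a
  assume "residue_rel x y" "residue_rel z w"
  then show "residue_rel (x - z) (y - w)"
    unfolding residue_rel_def
    using max_ideal_closed(2)[of "x - y" "- (z - w)"] max_ideal_closed(4)[of "z - w"]
    by (simp add: algebra_simps)
qed

lift_definition times_residue_field :: "'a residue_field \<Rightarrow> 'a residue_field \<Rightarrow> 'a residue_field"
  is "(*)"
proof -
  fix x y z w :: 'a
  assume "residue_rel x y" "residue_rel z w"
  then have "z * (x - y) \<in> max_ideal" "y * (z - w) \<in> max_ideal"
    unfolding residue_rel_def by (simp_all add: max_ideal_closed(3))
  then have "z * (x - y) + y * (z - w) \<in> max_ideal"
    by (rule max_ideal_closed(2))
  then show "residue_rel (x * z) (y * w)"
    unfolding residue_rel_def by (simp add: algebra_simps)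
qed

instance
proof
  show "(0 :: 'a residue_field) \<noteq> 1"
    by transfer (use max_ideal_closed(4)[of "- (1::'a)"] max_ideal_closed(5) in
      \<open>auto simp: residue_rel_def\<close>)
qed (transfer; simp add: residue_rel_def algebra_simps max_ideal_closed(1))+

end

lemma residue_field_inverse_ex:
  fixes x :: "'a::dvr residue_field"
  assumes "x \<noteq> 0"
  shows "\<exists>y. x * y = 1"
  using assms
  by transfer (use max_ideal_inverse in \<open>auto simp: residue_rel_def\<close>)

instantiation residue_field :: (dvr) field
begin

definition inverse_residue_field :: "'a residue_field \<Rightarrow> 'a residue_field" where
  "inverse_residue_field x = (if x = 0 then 0 else (SOME y. x * y = 1))"

definition divide_residue_field :: "'a residue_field \<Rightarrow> 'a residue_field \<Rightarrow> 'a residue_field" where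
  "divide_residue_field x y = x * inverse y"

instance
proof
  fix x y :: "'a residue_field"
  show "inverse x * x = 1" if "x \<noteq> 0"
    using someI_ex[OF residue_field_inverse_ex[OF that]] that
    by (simp add: inverse_residue_field_def mult.commute)
  show "x div y = x * inverse y"
    by (rule divide_residue_field_def)
  show "inverse (0 :: 'a residue_field) = 0"
    by (simp add: inverse_residue_field_def)
qed

end

section \<open>Algebras and extension of scalars\<close>

text \<open>
  The carrier \<open>A\<close> and the unit \<open>e\<close> are arguments because the subalgebras attached to linkage
  classes have units of their own. The ambient type is only required to be in class
  \<^class>\<open>ring\<close>, so that the zero algebra is allowed.
\<close>

definition unital_algebra ::
  "('r::comm_ring_1 \<Rightarrow> 'a::ring \<Rightarrow> 'a) \<Rightarrow> 'a set \<Rightarrow> 'a \<Rightarrow> bool" where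
  "unital_algebra scale A e \<longleftrightarrow>
     module scale \<and> module.subspace scale A \<and>
     (\<forall>x\<in>A. \<forall>y\<in>A. x * y \<in> A) \<and>
     (\<forall>r. \<forall>x\<in>A. \<forall>y\<in>A. scale r (x * y) = scale r x * y \<and> scale r (x * y) = x * scale r y) \<and>
     e \<in> A \<and> (\<forall>x\<in>A. e * x = x \<and> x * e = x)"

text \<open>
  The tensor product of an \<open>R\<close>-algebra \<open>A\<close> with a commutative ring \<open>S\<close>, regarded as an
  \<open>R\<close>-algebra through \<open>\<phi>\<close>, is the free abelian group on \<open>A \<times> S\<close> modulo the subgroup generated
  by \<open>tensor_relations\<close>. The ring \<open>B\<close> with \<open>tens a s\<close> in the role of the pure
  tensor of \<open>a\<close> and \<open>s\<close> is a model of it if the homomorphism \<open>tensor_eval\<close> from the free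
  abelian group to \<open>B\<close> is onto and its kernel is exactly that subgroup; multiplication and the
  action of \<open>S\<close> are then prescribed on pure tensors. In \<open>tensor_eval\<close>, an integer multiple
  is written as the action of the image of that integer in \<open>S\<close>, because \<open>B\<close> is in a class without unit.
\<close>

definition tensor_relations ::
  "('r \<Rightarrow> 'a::ring \<Rightarrow> 'a) \<Rightarrow> ('r \<Rightarrow> 's::comm_ring_1) \<Rightarrow> ('a \<times> 's \<Rightarrow>\<^sub>0 int) set" where
  "tensor_relations scale \<phi> =
     {frag_of (a + b, s) - frag_of (a, s) - frag_of (b, s) |a b s. True} \<union>
     {frag_of (a, s + t) - frag_of (a, s) - frag_of (a, t) |a s t. True} \<union>
     {frag_of (scale r a, s) - frag_of (a, \<phi> r * s) |r a s. True}"

definition tensor_eval ::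
  "('s::comm_ring_1 \<Rightarrow> 'b::ring \<Rightarrow> 'b) \<Rightarrow> ('a \<Rightarrow> 's \<Rightarrow> 'b) \<Rightarrow> ('a \<times> 's \<Rightarrow>\<^sub>0 int) \<Rightarrow> 'b" where
  "tensor_eval scaleB tens x =
     (\<Sum>(a, s)\<in>Poly_Mapping.keys x.
        scaleB (of_int (Poly_Mapping.lookup x (a, s))) (tens a s))"

definition is_scalar_extension ::
  "('r::comm_ring_1 \<Rightarrow> 'a::ring \<Rightarrow> 'a) \<Rightarrow> ('r \<Rightarrow> 's::comm_ring_1) \<Rightarrow>
   ('s \<Rightarrow> 'b::ring \<Rightarrow> 'b) \<Rightarrow> ('a \<Rightarrow> 's \<Rightarrow> 'b) \<Rightarrow> bool" where
  "is_scalar_extension scale \<phi> scaleB tens \<longleftrightarrow>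
     module scaleB \<and>
     surj (tensor_eval scaleB tens) \<and>
     {x. tensor_eval scaleB tens x = 0} = module.span frag_cmul (tensor_relations scale \<phi>) \<and>
     (\<forall>a b s t. tens a s * tens b t = tens (a * b) (s * t)) \<and>
     (\<forall>a s t. scaleB t (tens a s) = tens a (t * s))"

section \<open>Cellular algebras\<close>

definition cell_index :: "'l set \<Rightarrow> ('l \<Rightarrow> 't set) \<Rightarrow> ('l \<times> 't \<times> 't) set" where
  "cell_index \<Lambda> T = (SIGMA lam:\<Lambda>. T lam \<times> T lam)"

definition cell_basis_set ::
  "'l set \<Rightarrow> ('l \<Rightarrow> 't set) \<Rightarrow> ('l \<Rightarrow> 't \<Rightarrow> 't \<Rightarrow> 'a) \<Rightarrow> 'a set" where
  "cell_basis_set \<Lambda> T a = (\<lambda>(lam, s, t). a lam s t) ` cell_index \<Lambda> T"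

definition cell_higher ::
  "('r::comm_ring_1 \<Rightarrow> 'a::ring \<Rightarrow> 'a) \<Rightarrow> 'l::order set \<Rightarrow> ('l \<Rightarrow> 't set) \<Rightarrow>
   ('l \<Rightarrow> 't \<Rightarrow> 't \<Rightarrow> 'a) \<Rightarrow> 'l \<Rightarrow> 'a set" where
  "cell_higher scale \<Lambda> T a lam =
     module.span scale {a \<mu> y z |\<mu> y z. \<mu> \<in> \<Lambda> \<and> \<mu> > lam \<and> y \<in> T \<mu> \<and> z \<in> T \<mu>}"

text \<open>The linear map transposing the basis; only meaningful on the span of the basis.\<close>

definition cell_star ::
  "('r::comm_ring_1 \<Rightarrow> 'a::ring \<Rightarrow> 'a) \<Rightarrow> 'l set \<Rightarrow> ('l \<Rightarrow> 't set) \<Rightarrow>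
   ('l \<Rightarrow> 't \<Rightarrow> 't \<Rightarrow> 'a) \<Rightarrow> 'a \<Rightarrow> 'a" where
  "cell_star scale \<Lambda> T a x =
     (\<Sum>(lam, s, t)\<in>cell_index \<Lambda> T.
        scale (module.representation scale (cell_basis_set \<Lambda> T a) x (a lam s t)) (a lam t s))"

definition cellular_basis ::
  "('r::comm_ring_1 \<Rightarrow> 'a::ring \<Rightarrow> 'a) \<Rightarrow> 'a set \<Rightarrow> 'a \<Rightarrow> 'l::order set \<Rightarrow>
   ('l \<Rightarrow> 't set) \<Rightarrow> ('l \<Rightarrow> 't \<Rightarrow> 't \<Rightarrow> 'a) \<Rightarrow> bool" where
  "cellular_basis scale A e \<Lambda> T a \<longleftrightarrow>
     unital_algebra scale A e \<and>
     finite \<Lambda> \<and> (\<forall>lam\<in>\<Lambda>. finite (T lam)) \<and>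
     inj_on (\<lambda>(lam, s, t). a lam s t) (cell_index \<Lambda> T) \<and>
     \<not> module.dependent scale (cell_basis_set \<Lambda> T a) \<and>
     module.span scale (cell_basis_set \<Lambda> T a) = A \<and>
     (\<forall>x\<in>A. \<forall>lam\<in>\<Lambda>. \<forall>t\<in>T lam. \<exists>r. \<forall>s\<in>T lam.
        a lam s t * x - (\<Sum>v\<in>T lam. scale (r v) (a lam s v)) \<in> cell_higher scale \<Lambda> T a lam) \<and>
     bij_betw (cell_star scale \<Lambda> T a) A A \<and>
     (\<forall>x\<in>A. \<forall>y\<in>A. cell_star scale \<Lambda> T a (x * y) =
        cell_star scale \<Lambda> T a y * cell_star scale \<Lambda> T a x)"

section \<open>Jucys-Murphy elements\<close>

text \<open>
  The disjoint union of the sets \<open>T lam\<close> is \<^term>\<open>Sigma \<Lambda> T\<close>. The relation \<open>tgt lam v t\<close> is the strict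
  partial order \<open>v \<triangleright> t\<close> on \<open>T lam\<close>.
\<close>

definition jm_family ::
  "('r::comm_ring_1 \<Rightarrow> 'a::ring \<Rightarrow> 'a) \<Rightarrow> 'l::order set \<Rightarrow> ('l \<Rightarrow> 't set) \<Rightarrow>
   ('l \<Rightarrow> 't \<Rightarrow> 't \<Rightarrow> bool) \<Rightarrow> ('l \<Rightarrow> 't \<Rightarrow> 't \<Rightarrow> 'a) \<Rightarrow>
   nat \<Rightarrow> (nat \<Rightarrow> 'a) \<Rightarrow> ('l \<times> 't \<Rightarrow> nat \<Rightarrow> 'r) \<Rightarrow> bool" where
  "jm_family scale \<Lambda> T tgt a M L c \<longleftrightarrow>
     (\<forall>i\<in>{1..M}. \<forall>j\<in>{1..M}. L i * L j = L j * L i) \<and>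
     (\<forall>i\<in>{1..M}. cell_star scale \<Lambda> T a (L i) = L i) \<and>
     (\<forall>i\<in>{1..M}. \<forall>lam\<in>\<Lambda>. \<forall>t\<in>T lam. \<exists>r. \<forall>s\<in>T lam.
        a lam s t * L i -
          (scale (c (lam, t) i) (a lam s t) + (\<Sum>v | v \<in> T lam \<and> tgt lam v t. scale (r v) (a lam s v)))
        \<in> cell_higher scale \<Lambda> T a lam)"

definition jm_separates ::
  "'l set \<Rightarrow> ('l \<Rightarrow> 't set) \<Rightarrow> nat \<Rightarrow> ('l \<times> 't \<Rightarrow> nat \<Rightarrow> 'r) \<Rightarrow> bool" where
  "jm_separates \<Lambda> T M c \<longleftrightarrow>
     (\<forall>s\<in>Sigma \<Lambda> T. \<forall>t\<in>Sigma \<Lambda> T. s \<noteq> t \<longrightarrow> (\<exists>i\<in>{1..M}. c s i \<noteq> c t i))"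

text \<open>
  The product of a finite family of pairwise commuting elements, with \<open>e\<close> as empty product; the
  order in which the fold runs is then immaterial.
\<close>

definition commuting_prod :: "'b::ring \<Rightarrow> ('i \<Rightarrow> 'b) \<Rightarrow> 'i set \<Rightarrow> 'b" where
  "commuting_prod e f I = Finite_Set.fold (\<lambda>i x. f i * x) e I"

definition jm_F ::
  "('k::field \<Rightarrow> 'b::ring \<Rightarrow> 'b) \<Rightarrow> 'b \<Rightarrow> 'p set \<Rightarrow> nat \<Rightarrow> (nat \<Rightarrow> 'b) \<Rightarrow> ('p \<Rightarrow> nat \<Rightarrow> 'k) \<Rightarrow>
   'p \<Rightarrow> 'b" where
  "jm_F scale e P M L c t =
     commuting_prod e (\<lambda>(i, d). scale (1 / (c t i - d)) (L i - scale d e))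
       (SIGMA i:{1..M}. (\<lambda>s. c s i) ` P - {c t i})"

definition residue_class ::
  "'p set \<Rightarrow> nat \<Rightarrow> ('p \<Rightarrow> nat \<Rightarrow> 'r::dvr) \<Rightarrow> 'p \<Rightarrow> 'p set" where
  "residue_class P M c s = {t \<in> P. \<forall>i\<in>{1..M}. residue (c s i) = residue (c t i)}"

definition linkage_step ::
  "'l set \<Rightarrow> ('l \<Rightarrow> 't set) \<Rightarrow> nat \<Rightarrow> ('l \<times> 't \<Rightarrow> nat \<Rightarrow> 'r::dvr) \<Rightarrow> ('l \<times> 'l) set" where
  "linkage_step \<Lambda> T M c =
     {(lam, \<mu>). lam \<in> \<Lambda> \<and> \<mu> \<in> \<Lambda> \<and>
        (\<exists>s\<in>T lam. \<exists>t\<in>T \<mu>. (\<mu>, t) \<in> residue_class (Sigma \<Lambda> T) M c (lam, s))}"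

definition linkage_classes ::
  "'l set \<Rightarrow> ('l \<Rightarrow> 't set) \<Rightarrow> nat \<Rightarrow> ('l \<times> 't \<Rightarrow> nat \<Rightarrow> 'r::dvr) \<Rightarrow> 'l set set" where
  "linkage_classes \<Lambda> T M c = \<Lambda> // ((linkage_step \<Lambda> T M c)\<^sup>* \<inter> \<Lambda> \<times> \<Lambda>)"

text \<open>
  \<open>tensK\<close> and \<open>tensk\<close> are the pure tensors of the extensions of the \<open>R\<close>-algebra with unit \<open>one\<close> to
  the field of fractions and to the residue field, so \<open>tensk x 1\<close> is the reduction of \<open>x\<close>, and the
  definite description below is the element of the \<open>R\<close>-algebra whose image under
  \<open>y \<mapsto> tensK y 1\<close> is the sum of the \<open>F\<close>s.
\<close>

definition jm_G ::
  "('r::dvr fract \<Rightarrow> 'aK::ring \<Rightarrow> 'aK) \<Rightarrow> ('a::ring \<Rightarrow> 'r fract \<Rightarrow> 'aK) \<Rightarrow>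
   ('a \<Rightarrow> 'r residue_field \<Rightarrow> 'ak::ring) \<Rightarrow> 'a \<Rightarrow> 'p set \<Rightarrow> nat \<Rightarrow> (nat \<Rightarrow> 'a) \<Rightarrow>
   ('p \<Rightarrow> nat \<Rightarrow> 'r) \<Rightarrow> 'p set \<Rightarrow> 'ak" where
  "jm_G scaleK tensK tensk one P M L c \<T> =
     tensk (THE y. tensK y 1 =
        (\<Sum>t\<in>\<T>. jm_F scaleK (tensK one 1) P M (\<lambda>i. tensK (L i) 1) (\<lambda>s i. Fract (c s i) 1) t)) 1"

definition jm_g ::
  "('r::dvr fract \<Rightarrow> 'aK::ring \<Rightarrow> 'aK) \<Rightarrow> ('a::ring \<Rightarrow> 'r fract \<Rightarrow> 'aK) \<Rightarrow>
   ('a \<Rightarrow> 'r residue_field \<Rightarrow> 'ak::ring) \<Rightarrow> 'a \<Rightarrow> 'l set \<Rightarrow> ('l \<Rightarrow> 't set) \<Rightarrow>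
   ('l \<Rightarrow> 't \<Rightarrow> 't \<Rightarrow> 'a) \<Rightarrow> nat \<Rightarrow> (nat \<Rightarrow> 'a) \<Rightarrow> ('l \<times> 't \<Rightarrow> nat \<Rightarrow> 'r) \<Rightarrow>
   'l \<Rightarrow> 't \<Rightarrow> 't \<Rightarrow> 'ak" where
  "jm_g scaleK tensK tensk one \<Lambda> T a M L c lam s t =
     (let P = Sigma \<Lambda> T;
          G = (\<lambda>u. jm_G scaleK tensK tensk one P M L c (residue_class P M c (lam, u)))
      in G s * tensk (a lam s t) 1 * G t)"

definition linkage_component ::
  "('k::comm_ring_1 \<Rightarrow> 'b::ring \<Rightarrow> 'b) \<Rightarrow> ('l \<Rightarrow> 't set) \<Rightarrow> ('l \<Rightarrow> 't \<Rightarrow> 't \<Rightarrow> 'b) \<Rightarrow>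
   'l set \<Rightarrow> 'b set" where
  "linkage_component scale T g \<Gamma> = module.span scale (cell_basis_set \<Gamma> T g)"

text \<open>
  Internal direct sum of algebras: unique decomposition, and the summands annihilate each other,
  so that multiplication is componentwise.
\<close>

definition algebra_direct_sum :: "'b::ring set \<Rightarrow> 'i set \<Rightarrow> ('i \<Rightarrow> 'b set) \<Rightarrow> bool" where
  "algebra_direct_sum A I B \<longleftrightarrow>
     (\<forall>i\<in>I. B i \<subseteq> A) \<and>
     (\<forall>x\<in>A. \<exists>!y. y \<in> (\<Pi>\<^sub>E i\<in>I. B i) \<and> x = (\<Sum>i\<in>I. y i)) \<and>
     (\<forall>i\<in>I. \<forall>j\<in>I. i \<noteq> j \<longrightarrow> (\<forall>x\<in>B i. \<forall>y\<in>B j. x * y = 0))"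

end

theory Submission
  imports Defs
begin

text \<open>
  Everything is governed by the polynomials in the Jucys--Murphy elements. Substituting the contents
  \<open>c p i\<close> for the \<open>L i\<close> gives such a polynomial \<open>x\<close> a value at every \<open>p \<in> Sigma \<Lambda> T\<close>; the relation
  \<open>jm_poly\<close> keeps track of \<open>x\<close> together with its value function. Multiplication by \<open>x\<close>, on either side,
  is triangular for the cellular basis, and its diagonal entries are the values of \<open>x\<close>.

  The key fact is \<open>jm_poly_eq_zero\<close>: over a domain over which the contents separate \<open>Sigma \<Lambda> T\<close>, a
  polynomial all of whose values vanish is zero. The left and the right multiplications by the
  \<open>L i\<close> form one commuting family of triangular operators, and on \<open>a l s t\<close> their joint eigenvalue is
  the pair of content vectors of \<open>(l, s)\<close> and \<open>(l, t)\<close>, so that different basis vectors have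
  different joint eigenvalues. An operator which commutes with such a family and has zero
  diagonal must vanish, and left multiplication by \<open>x\<close> is one. Looking at both sides
  at once is essential: the eigenvalues of the right multiplications alone are repeated, once for each \<open>s\<close>.

  So over \<open>R\<close> and over \<open>K\<close> identities between polynomials may be checked on values. The value function
  of \<open>F\<^sub>t\<close> is the indicator function of \<open>t\<close>. Contents with different residues differ by a unit of \<open>R\<close>, and
  therefore the indicator function of a residue class \<open>\<T>\<close> is the value function of a polynomial with
  coefficients in \<open>R\<close> (\<open>poly_residue_class_indicator\<close>). Comparing values over \<open>K\<close> shows that this
  polynomial is the element of \<open>A\<close> which maps to the sum of the \<open>F\<^sub>t\<close> with \<open>t \<in> \<T>\<close>; comparing values over \<open>R\<close>
  shows that the polynomials of two different residue classes multiply to zero.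

  Both properties survive reduction modulo the maximal ideal, where separation is lost. Thus
  the element \<open>G\<close> of a residue class is a polynomial in the reduced \<open>L i\<close>, fixed by the involution,
  with value \<open>1\<close> on the class. Hence the \<open>g l s t\<close> arise from the \<open>a l s t\<close> by a unitriangular change of basis
  which respects the cell filtration and the involution (\<open>cellular_basis_twist\<close>), and this gives
  the first claim. If \<open>l\<close> and \<open>m\<close> are not linked, then no residue class meets both \<open>T l\<close> and \<open>T m\<close>, so
  \<open>g l s t * g m u v\<close> contains a product of the \<open>G\<close>s of two different classes and is zero.
  The other two claims follow, because
  a cellular basis that falls into mutually annihilating blocks splits the algebra into a
  direct sum of cellular algebras (locale \<open>cellular_blocks\<close>).
\<close>

section \<open>Finite free families\<close>

locale free_family = module scale
  for scale :: "'r::comm_ring_1 \<Rightarrow> 'a::ab_group_add \<Rightarrow> 'a" (infixr \<open>*s\<close> 75) +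
  fixes I :: "'i set" and b :: "'i \<Rightarrow> 'a"
  assumes finite_index: "finite I"
    and inj_family: "inj_on b I"
    and independent_family: "independent (b ` I)"
begin

definition coord :: "'a \<Rightarrow> 'i \<Rightarrow> 'r" where
  "coord x j = representation (b ` I) x (b j)"

lemma sum_coord:
  assumes "x \<in> span (b ` I)"
  shows "(\<Sum>j\<in>I. coord x j *s b j) = x"
  using sum_representation_eq[OF independent_family assms _ order_refl] finite_index
  by (simp add: coord_def sum.reindex[OF inj_family])

lemma sum_eq_zeroD:
  assumes "(\<Sum>j\<in>I. y j *s b j) = 0" and "j \<in> I"
  shows "y j = 0"
proof -
  define u where "u v = y (the_inv_into I b v)" for v
  have u: "u (b i) = y i" if "i \<in> I" for i
    using that by (simp add: u_def the_inv_into_f_f[OF inj_family])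
  have "(\<Sum>v\<in>b ` I. u v *s v) = (\<Sum>j\<in>I. y j *s b j)"
    by (simp add: sum.reindex[OF inj_family] u)
  then have "u (b j) = 0"
    using independentD[OF independent_family _ order_refl, of u "b j"] assms finite_index by simp
  then show ?thesis using u[OF assms(2)] by simp
qed

lemma in_span_sum: "(\<And>j. j \<in> J \<Longrightarrow> j \<in> U) \<Longrightarrow> (\<Sum>j\<in>J. y j *s b j) \<in> span (b ` U)"
  by (intro span_sum span_scale span_base) auto

lemma coord_sum_family:
  assumes "j \<in> I"
  shows "coord (\<Sum>i\<in>I. y i *s b i) j = y j"
proof -
  let ?x = "\<Sum>i\<in>I. y i *s b i"
  have "(\<Sum>i\<in>I. coord ?x i *s b i) = ?x"
    by (rule sum_coord) (rule in_span_sum)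
  then have "(\<Sum>i\<in>I. (coord ?x i - y i) *s b i) = 0"
    by (simp add: scale_left_diff_distrib sum_subtractf)
  from sum_eq_zeroD[OF this assms] show ?thesis by simp
qed

lemma coord_unique:
  assumes "x = (\<Sum>i\<in>I. y i *s b i)" and "j \<in> I"
  shows "coord x j = y j"
  using coord_sum_family assms by simp

lemma coord_add:
  assumes "x \<in> span (b ` I)" "y \<in> span (b ` I)" "j \<in> I"
  shows "coord (x + y) j = coord x j + coord y j"
  by (rule coord_unique[OF _ assms(3)])
    (simp add: scale_left_distrib sum.distrib sum_coord assms)

lemma coord_scale:
  assumes "x \<in> span (b ` I)" "j \<in> I"
  shows "coord (r *s x) j = r * coord x j"
proof (rule coord_unique[OF _ assms(2)])
  have "r *s x = r *s (\<Sum>i\<in>I. coord x i *s b i)" by (simp add: sum_coord assms)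
  then show "r *s x = (\<Sum>i\<in>I. (r * coord x i) *s b i)" by (simp add: scale_sum_right)
qed

lemma coord_zero: "j \<in> I \<Longrightarrow> coord 0 j = 0"
  by (rule coord_unique[where y = "\<lambda>_. 0"]) simp_all

lemma coord_diff:
  assumes "x \<in> span (b ` I)" "y \<in> span (b ` I)" "j \<in> I"
  shows "coord (x - y) j = coord x j - coord y j"
  by (rule coord_unique[OF _ assms(3)])
    (simp add: scale_left_diff_distrib sum_subtractf sum_coord assms)

lemma coord_sum:
  assumes "\<And>i. i \<in> J \<Longrightarrow> f i \<in> span (b ` I)" "j \<in> I"
  shows "coord (sum f J) j = (\<Sum>i\<in>J. coord (f i) j)"
proof (cases "finite J")
  case True
  then show ?thesis using assms
    by (induction J) (simp_all add: coord_zero coord_add span_sum)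
qed (simp add: coord_zero assms)

lemma coord_family: "i \<in> I \<Longrightarrow> j \<in> I \<Longrightarrow> coord (b i) j = (if j = i then 1 else 0)"
  by (rule coord_unique) (simp_all add: if_distrib[of "\<lambda>r. r *s _"] sum.delta finite_index cong: if_cong)

lemma span_subfamily_iff:
  assumes x: "x \<in> span (b ` I)" and U: "U \<subseteq> I"
  shows "x \<in> span (b ` U) \<longleftrightarrow> (\<forall>j\<in>I - U. coord x j = 0)"
proof
  let ?V = "{x \<in> span (b ` I). \<forall>j\<in>I - U. coord x j = 0}"
  have "subspace ?V"
    by (rule subspaceI) (auto simp: span_zero span_add span_scale coord_zero coord_add coord_scale)
  moreover have "b ` U \<subseteq> ?V"
    using U by (auto simp: coord_family intro: span_base)
  ultimately have "span (b ` U) \<subseteq> ?V" by (rule span_minimal[rotated])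
  then show "x \<in> span (b ` U) \<Longrightarrow> \<forall>j\<in>I - U. coord x j = 0" by blast
next
  assume 0: "\<forall>j\<in>I - U. coord x j = 0"
  have "x = (\<Sum>j\<in>I. coord x j *s b j)" by (simp add: sum_coord x)
  also have "\<dots> = (\<Sum>j\<in>U. coord x j *s b j)"
    using 0 U finite_index by (intro sum.mono_neutral_right) auto
  also have "\<dots> \<in> span (b ` U)" by (rule in_span_sum)
  finally show "x \<in> span (b ` U)" .
qed

text \<open>
  The order is encoded by a height function with values in \<open>nat\<close>; the set \<open>U\<close> is arbitrary so that the
  lemma also compares the filtrations of two bases, not only their spans.
\<close>
lemma span_unitriangular:
  fixes h :: "'i \<Rightarrow> nat"
  assumes U: "U \<subseteq> I" and g: "\<And>j. j \<in> U \<Longrightarrow> g j - b j \<in> span (b ` {i \<in> U. h j < h i})"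
  shows "span (g ` U) = span (b ` U)"
proof
  have "g j \<in> span (b ` U)" if "j \<in> U" for j
  proof -
    have "g j - b j \<in> span (b ` U)"
      by (rule subsetD[OF span_mono g[OF that]]) auto
    from span_add[OF this span_base[of "b j"]] that show ?thesis by simp
  qed
  then show "span (g ` U) \<subseteq> span (b ` U)"
    by (intro span_minimal) auto
next
  obtain n where n: "\<And>j. j \<in> U \<Longrightarrow> h j \<le> n"
    using finite_subset[OF U finite_index] by (metis Max_ge finite_imageI imageI)
  have "b j \<in> span (g ` U)" if "j \<in> U" for j
    using that
  proof (induction "n - h j" arbitrary: j rule: less_induct)
    case less
    have "b ` {i \<in> U. h j < h i} \<subseteq> span (g ` U)"
    proof clarify
      fix i assume "i \<in> U" "h j < h i"
      then show "b i \<in> span (g ` U)" using n[of i] n[of j] less.prems by (intro less.hyps) auto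
    qed
    then have "g j - b j \<in> span (g ` U)"
      using g[OF less.prems] span_minimal[OF _ subspace_span] by blast
    from span_diff[OF span_base[of "g j" "g ` U"] this] less.prems show ?case by simp
  qed
  then show "span (b ` U) \<subseteq> span (g ` U)"
    by (intro span_minimal) auto
qed

end

lemma (in module) free_familyI:
  assumes fin: "finite I"
    and zero: "\<And>y j. (\<Sum>j\<in>I. scale (y j) (b j)) = 0 \<Longrightarrow> j \<in> I \<Longrightarrow> y j = 0"
  shows "free_family scale I b"
proof unfold_locales
  show "finite I" by (rule fin)
  show inj: "inj_on b I"
  proof (rule inj_onI, rule ccontr)
    fix i j assume ij: "i \<in> I" "j \<in> I" "b i = b j" "i \<noteq> j"
    (* a repetition in the family gives the relation b i - b j = 0 *)
    let ?y = "\<lambda>l. (if l = i then 1 else 0) - (if l = j then 1 else 0)"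
    have "(\<Sum>l\<in>I. ?y l *s b l) = 0"
      using ij fin by (simp add: scale_left_diff_distrib sum_subtractf if_distrib[of "\<lambda>r. r *s _"]
        sum.delta cong: if_cong)
    from zero[OF this ij(1)] ij(4) show False by simp
  qed
  show "independent (b ` I)"
  proof
    assume "dependent (b ` I)"
    then obtain u v where "(\<Sum>v\<in>b ` I. u v *s v) = 0" "v \<in> b ` I" "u v \<noteq> 0"
      using dependent_finite[of "b ` I"] fin by auto
    with zero[of "u \<circ> b"] show False by (auto simp: sum.reindex[OF inj])
  qed
qed

text \<open>
  In a vanishing combination of the \<open>g j\<close>, the coefficients are read off in order of increasing height:
  once all lower ones are known to vanish, the coordinate at \<open>b m\<close> is the coefficient of \<open>g m\<close>.
\<close>
lemma (in free_family) free_family_unitriangular: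
  fixes h :: "'i \<Rightarrow> nat"
  assumes g: "\<And>j. j \<in> I \<Longrightarrow> g j - b j \<in> span (b ` {i \<in> I. h j < h i})"
  shows "free_family scale I g"
proof (rule free_familyI[OF finite_index])
  fix y m assume sum0: "(\<Sum>j\<in>I. y j *s g j) = 0" and m: "m \<in> I"
  have sp: "g j \<in> span (b ` I)" if "j \<in> I" for j
    using span_unitriangular[OF order_refl g] span_base[of "g j" "g ` I"] that by simp
  have coord_g: "coord (g j) i = (if i = j then 1 else 0)"
    if "j \<in> I" "i \<in> I" "h i \<le> h j" for i j
  proof -
    have "coord (g j - b j) i = 0"
      using span_subfamily_iff[OF span_diff[OF sp[OF that(1)] span_base[of "b j"]], of "{i \<in> I. h j < h i}"]
        g[OF that(1)] that by simp
    moreover have "coord (g j - b j) i = coord (g j) i - coord (b j) i"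
      using that by (intro coord_diff sp span_base) auto
    ultimately show ?thesis using that by (simp add: coord_family)
  qed
  show "y m = 0"
    using m
  proof (induction "h m" arbitrary: m rule: less_induct)
    case less
    have "0 = coord (\<Sum>j\<in>I. y j *s g j) m" by (simp add: sum0 coord_zero less.prems)
    also have "\<dots> = (\<Sum>j\<in>I. y j * coord (g j) m)"
      by (simp add: coord_sum coord_scale sp span_scale less.prems)
    also have "\<dots> = (\<Sum>j\<in>I. if j = m then y m else 0)"
    proof (rule sum.cong[OF refl])
      fix j assume "j \<in> I"
      then show "y j * coord (g j) m = (if j = m then y m else 0)"
        using less coord_g[of j m] by (cases "h j < h m") auto
    qed
    also have "\<dots> = y m" using less.prems finite_index by simp
    finally show ?case by simp
  qed
qed

text \<open>Any strict order on a finite set is refined by comparing heights, where the height of an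
  element counts what lies below it.\<close>

lemma finite_strict_order_height:
  assumes "finite I" and irr: "irreflp_on I R" and tr: "transp_on I R"
  obtains h :: "'i \<Rightarrow> nat" where "\<And>i j. i \<in> I \<Longrightarrow> j \<in> I \<Longrightarrow> R i j \<Longrightarrow> h i < h j"
proof
  fix i j assume ij: "i \<in> I" "j \<in> I" "R i j"
  have "{l \<in> I. R l i} \<subset> {l \<in> I. R l j}"
    using ij irr tr unfolding transp_on_def irreflp_on_def by blast
  then show "card {l \<in> I. R l i} < card {l \<in> I. R l j}"
    using assms(1) by (intro psubset_card_mono) auto
qed

text \<open>
  Suppose that \<open>Y\<close> kills all basis vectors higher than \<open>b j\<close>, and let \<open>b m\<close> be of least height among the
  basis vectors occurring in \<open>Y (b j)\<close>. If \<open>X\<close> has diagonal entries \<open>d\<close>, then \<open>X (b j) - d j *s b j\<close> is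
  killed by \<open>Y\<close>, so \<open>Y (b j)\<close> is an eigenvector of \<open>X\<close> for \<open>d j\<close>; but the coefficient of \<open>b m\<close> in it is
  multiplied by \<open>d m\<close>. The choice of an \<open>X\<close> with \<open>d m \<noteq> d j\<close> gives a contradiction. The argument
  constructs no eigenvectors and never divides.
\<close>
lemma strictly_triangular_commuting_zero:
  fixes scale :: "'r::idom \<Rightarrow> 'a::ab_group_add \<Rightarrow> 'a" (infixr \<open>*s\<close> 75) and h :: "'i \<Rightarrow> nat"
  assumes fam: "free_family scale I b"
    and spanning: "module.span scale (b ` I) = UNIV"
    and Y: "module_hom scale scale Y"
    and Y_strict: "\<And>i j. i \<in> I \<Longrightarrow> j \<in> I \<Longrightarrow> free_family.coord scale I b (Y (b i)) j \<noteq> 0 \<Longrightarrow> h i < h j"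
    and sep: "\<And>i j. i \<in> I \<Longrightarrow> j \<in> I \<Longrightarrow> i \<noteq> j \<Longrightarrow>
      \<exists>X d. module_hom scale scale X \<and> (\<forall>x. X (Y x) = Y (X x)) \<and>
        (\<forall>i\<in>I. free_family.coord scale I b (X (b i)) i = d i) \<and>
        (\<forall>i\<in>I. \<forall>j\<in>I. i \<noteq> j \<longrightarrow> free_family.coord scale I b (X (b i)) j \<noteq> 0 \<longrightarrow> h i < h j) \<and>
        d i \<noteq> d j"
  shows "Y x = 0"
proof -
  interpret free_family scale I b by (rule fam)
  interpret Y: module_hom scale scale Y by (rule Y)
  have UN [simp]: "x \<in> span (b ` I)" for x using spanning by simp
  obtain n where n: "\<And>j. j \<in> I \<Longrightarrow> h j \<le> n"
    using finite_index by (metis Max_ge finite_imageI imageI)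
  have Yb: "Y (b j) = 0" if "j \<in> I" for j
    using that
  proof (induction "n - h j" arbitrary: j rule: less_induct)
    case less
    have IH: "Y (b i) = 0" if "i \<in> I" "h j < h i" for i
      using n[of i] n[of j] less.prems that by (intro less.hyps) auto
    show ?case
    proof (rule ccontr)
      assume nz: "Y (b j) \<noteq> 0"
      let ?y = "coord (Y (b j))"
      have y: "Y (b j) = (\<Sum>i\<in>I. ?y i *s b i)" by (rule sum_coord[symmetric]) simp
      obtain m0 where "m0 \<in> I \<and> ?y m0 \<noteq> 0"
        using nz y by (metis (no_types, lifting) scale_zero_left sum.neutral)
      from ex_has_least_nat[of "\<lambda>m. m \<in> I \<and> ?y m \<noteq> 0", OF this, of h]
      obtain m where m: "m \<in> I" "?y m \<noteq> 0"
        and least: "\<And>i. i \<in> I \<Longrightarrow> ?y i \<noteq> 0 \<Longrightarrow> h m \<le> h i" by blast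
      have "m \<noteq> j" using Y_strict[OF less.prems m(1) m(2)] by auto
      from sep[OF m(1) less.prems this] obtain X d where X: "module_hom scale scale X"
        and comm: "\<And>x. X (Y x) = Y (X x)"
        and diag: "\<And>i. i \<in> I \<Longrightarrow> coord (X (b i)) i = d i"
        and tri: "\<And>i j. i \<in> I \<Longrightarrow> j \<in> I \<Longrightarrow> i \<noteq> j \<Longrightarrow> coord (X (b i)) j \<noteq> 0 \<Longrightarrow> h i < h j"
        and dmj: "d m \<noteq> d j" by blast
      interpret X: module_hom scale scale X by (rule X)
      have Xb: "X (b j) = d j *s b j + (\<Sum>i\<in>I - {j}. coord (X (b j)) i *s b i)"
        using sum_coord[of "X (b j)"] less.prems finite_index diag
        by (simp add: sum.remove)
      have "Y (X (b j)) = d j *s Y (b j) + (\<Sum>i\<in>I - {j}. coord (X (b j)) i *s Y (b i))"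
        by (subst Xb) (simp add: Y.add Y.scale Y.sum)
      also have "(\<Sum>i\<in>I - {j}. coord (X (b j)) i *s Y (b i)) = 0"
      proof (rule sum.neutral, rule ballI)
        fix i assume "i \<in> I - {j}"
        then show "coord (X (b j)) i *s Y (b i) = 0"
          using tri[of j i] less.prems IH[of i] by (cases "coord (X (b j)) i = 0") auto
      qed
      finally have "coord (X (Y (b j))) m = d j * ?y m"
        using m(1) by (simp add: comm coord_scale)
      moreover have "coord (X (Y (b j))) m = (\<Sum>i\<in>I. ?y i * coord (X (b i)) m)"
        using m(1) by (subst y) (simp add: X.sum X.scale coord_sum coord_scale)
      also have "\<dots> = (\<Sum>i\<in>I. if i = m then ?y m * d m else 0)"
      proof (rule sum.cong[OF refl])
        fix i assume "i \<in> I"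
        then show "?y i * coord (X (b i)) m = (if i = m then ?y m * d m else 0)"
          using tri[of i m] least[of i] m diag[of m]
          by (cases "i = m"; cases "?y i = 0"; cases "coord (X (b i)) m = 0") simp_all
      qed
      also have "\<dots> = ?y m * d m" using m finite_index by simp
      finally show False using m(2) dmj by simp
    qed
  qed
  have "Y x = (\<Sum>i\<in>I. coord x i *s Y (b i))"
    using sum_coord[of x] by (metis (no_types, lifting) UN Y.scale Y.sum sum.cong)
  also have "\<dots> = 0" by (simp add: Yb)
  finally show ?thesis .
qed

section \<open>Cellular algebras\<close>

lemma cell_star_coord:
  fixes scale :: "'r::comm_ring_1 \<Rightarrow> 'a::ring \<Rightarrow> 'a" (infixr \<open>*s\<close> 75)
  assumes "free_family scale (cell_index \<Lambda> T) (\<lambda>(l, s, t). a l s t)"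
  shows "cell_star scale \<Lambda> T a x =
    (\<Sum>(l, s, t)\<in>cell_index \<Lambda> T.
      scale (free_family.coord scale (cell_index \<Lambda> T) (\<lambda>(l, s, t). a l s t) x (l, s, t)) (a l t s))"
  using free_family.coord_def[OF assms] by (simp add: cell_star_def cell_basis_set_def)

text \<open>
  The involutions of the twisted basis and of a block are recognised with this lemma as the
  involution of the original cellular basis.
\<close>
lemma cell_star_eqI:
  fixes scale :: "'r::comm_ring_1 \<Rightarrow> 'a::ring \<Rightarrow> 'a" (infixr \<open>*s\<close> 75)
  assumes fam: "free_family scale (cell_index \<Lambda> T) (\<lambda>(l, s, t). a l s t)"
    and hom: "module_hom scale scale \<sigma>"
    and swap: "\<And>l s t. l \<in> \<Lambda> \<Longrightarrow> s \<in> T l \<Longrightarrow> t \<in> T l \<Longrightarrow> \<sigma> (a l s t) = a l t s"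
    and x: "x \<in> module.span scale (cell_basis_set \<Lambda> T a)"
  shows "cell_star scale \<Lambda> T a x = \<sigma> x"
proof -
  interpret free_family scale "cell_index \<Lambda> T" "\<lambda>(l, s, t). a l s t" by (rule fam)
  interpret \<sigma>: module_hom scale scale \<sigma> by (rule hom)
  have "\<sigma> x = \<sigma> (\<Sum>j\<in>cell_index \<Lambda> T. coord x j *s (\<lambda>(l, s, t). a l s t) j)"
    using sum_coord x by (simp add: cell_basis_set_def)
  also have "\<dots> = (\<Sum>(l, s, t)\<in>cell_index \<Lambda> T. coord x (l, s, t) *s a l t s)"
    unfolding \<sigma>.sum
    by (rule sum.cong) (auto simp: \<sigma>.scale swap cell_index_def)
  finally show ?thesis by (simp add: cell_star_coord[OF fam])
qed

lemma cell_star_hom: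
  fixes scale :: "'r::comm_ring_1 \<Rightarrow> 'a::ring \<Rightarrow> 'a" (infixr \<open>*s\<close> 75)
  assumes fam: "free_family scale (cell_index \<Lambda> T) (\<lambda>(l, s, t). a l s t)"
  defines "V \<equiv> module.span scale (cell_basis_set \<Lambda> T a)"
  shows cell_star_add: "x \<in> V \<Longrightarrow> y \<in> V \<Longrightarrow>
      cell_star scale \<Lambda> T a (x + y) = cell_star scale \<Lambda> T a x + cell_star scale \<Lambda> T a y"
    and cell_star_scale: "x \<in> V \<Longrightarrow>
      cell_star scale \<Lambda> T a (scale r x) = scale r (cell_star scale \<Lambda> T a x)"
    and cell_star_basis: "l \<in> \<Lambda> \<Longrightarrow> s \<in> T l \<Longrightarrow> t \<in> T l \<Longrightarrow> cell_star scale \<Lambda> T a (a l s t) = a l t s"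
    and cell_star_closed: "cell_star scale \<Lambda> T a x \<in> V"
proof -
  interpret free_family scale "cell_index \<Lambda> T" "\<lambda>(l, s, t). a l s t" by (rule fam)
  show "x \<in> V \<Longrightarrow> y \<in> V \<Longrightarrow>
      cell_star scale \<Lambda> T a (x + y) = cell_star scale \<Lambda> T a x + cell_star scale \<Lambda> T a y"
    unfolding cell_star_coord[OF fam] V_def cell_basis_set_def sum.distrib[symmetric]
    by (rule sum.cong) (auto simp: coord_add scale_left_distrib)
  show "x \<in> V \<Longrightarrow> cell_star scale \<Lambda> T a (scale r x) = scale r (cell_star scale \<Lambda> T a x)"
    unfolding cell_star_coord[OF fam] V_def cell_basis_set_def scale_sum_right
    by (rule sum.cong) (auto simp: coord_scale)
  show "cell_star scale \<Lambda> T a x \<in> V"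
    unfolding cell_star_coord[OF fam] V_def cell_basis_set_def
  proof (intro span_sum, clarify)
    fix l s t assume "(l, s, t) \<in> cell_index \<Lambda> T"
    then have "(l, t, s) \<in> cell_index \<Lambda> T" by (simp add: cell_index_def)
    from span_scale[OF span_base[OF imageI[OF this, of "\<lambda>(l, s, t). a l s t"]]]
    show "coord x (l, s, t) *s a l t s \<in> span ((\<lambda>(l, s, t). a l s t) ` cell_index \<Lambda> T)"
      by simp
  qed
  show "cell_star scale \<Lambda> T a (a l s t) = a l t s" if "l \<in> \<Lambda>" "s \<in> T l" "t \<in> T l"
  proof -
    have i: "(l, s, t) \<in> cell_index \<Lambda> T" using that by (simp add: cell_index_def)
    have "coord (a l s t) j = (if j = (l, s, t) then 1 else 0)" if "j \<in> cell_index \<Lambda> T" for j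
      using coord_family[OF i that] by simp
    then have "cell_star scale \<Lambda> T a (a l s t) =
        (\<Sum>j\<in>cell_index \<Lambda> T. if j = (l, s, t) then a l t s else 0)"
      unfolding cell_star_coord[OF fam] by (intro sum.cong) (auto split: if_splits)
    also have "\<dots> = a l t s" using i finite_index by simp
    finally show ?thesis .
  qed
qed

lemma cell_star_involution:
  fixes scale :: "'r::comm_ring_1 \<Rightarrow> 'a::ring \<Rightarrow> 'a" (infixr \<open>*s\<close> 75)
  assumes fam: "free_family scale (cell_index \<Lambda> T) (\<lambda>(l, s, t). a l s t)"
    and x: "x \<in> module.span scale (cell_basis_set \<Lambda> T a)"
  shows "cell_star scale \<Lambda> T a (cell_star scale \<Lambda> T a x) = x"
proof -
  interpret free_family scale "cell_index \<Lambda> T" "\<lambda>(l, s, t). a l s t" by (rule fam)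
  note star = cell_star_hom[OF fam]
  let ?star = "cell_star scale \<Lambda> T a"
  have "x \<in> {x \<in> span (cell_basis_set \<Lambda> T a). ?star (?star x) = x}"
  proof (rule span_subspace_induct[OF x])
    have "?star 0 = 0" using star(2)[of 0 0] span_zero by simp
    then show "subspace {x \<in> span (cell_basis_set \<Lambda> T a). ?star (?star x) = x}"
      by (intro subspaceI) (auto simp: star span_zero span_add span_scale)
    show "x \<in> {x \<in> span (cell_basis_set \<Lambda> T a). ?star (?star x) = x}"
      if "x \<in> cell_basis_set \<Lambda> T a" for x
      using that by (auto simp: star span_base) (auto simp: cell_basis_set_def cell_index_def star)
  qed
  then show ?thesis by simp
qed

text \<open>Bijectivity of the involution is automatic, since it squares to the identity.\<close>
lemma cellular_basisI:
  fixes scale :: "'r::comm_ring_1 \<Rightarrow> 'a::ring \<Rightarrow> 'a" (infixr \<open>*s\<close> 75)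
  assumes alg: "unital_algebra scale A e"
    and fin: "finite \<Lambda>" "\<And>l. l \<in> \<Lambda> \<Longrightarrow> finite (T l)"
    and fam: "free_family scale (cell_index \<Lambda> T) (\<lambda>(l, s, t). a l s t)"
    and span: "module.span scale (cell_basis_set \<Lambda> T a) = A"
    and cell: "\<And>x l t. x \<in> A \<Longrightarrow> l \<in> \<Lambda> \<Longrightarrow> t \<in> T l \<Longrightarrow> \<exists>r. \<forall>s\<in>T l.
        a l s t * x - (\<Sum>v\<in>T l. scale (r v) (a l s v)) \<in> cell_higher scale \<Lambda> T a l"
    and anti: "\<And>x y. x \<in> A \<Longrightarrow> y \<in> A \<Longrightarrow> cell_star scale \<Lambda> T a (x * y) =
        cell_star scale \<Lambda> T a y * cell_star scale \<Lambda> T a x"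
  shows "cellular_basis scale A e \<Lambda> T a"
proof -
  interpret free_family scale "cell_index \<Lambda> T" "\<lambda>(l, s, t). a l s t" by (rule fam)
  have "bij_betw (cell_star scale \<Lambda> T a) A A"
    using cell_star_involution[OF fam] cell_star_closed[OF fam] span
    by (intro bij_betw_byWitness[where f' = "cell_star scale \<Lambda> T a"]) auto
  then show ?thesis
    unfolding cellular_basis_def
    using assms inj_family independent_family by (auto simp: cell_basis_set_def)
qed

locale cellular_algebra =
  fixes scale :: "'r::comm_ring_1 \<Rightarrow> 'a::ring \<Rightarrow> 'a" (infixr \<open>*s\<close> 75)
    and e :: 'a and \<Lambda> :: "'l::order set" and T :: "'l \<Rightarrow> 't set"
    and a :: "'l \<Rightarrow> 't \<Rightarrow> 't \<Rightarrow> 'a"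
  assumes cellular: "cellular_basis scale UNIV e \<Lambda> T a"

sublocale cellular_algebra \<subseteq> free_family scale "cell_index \<Lambda> T" "\<lambda>(l, s, t). a l s t"
proof -
  have *: "module scale" "finite \<Lambda>" "\<forall>l\<in>\<Lambda>. finite (T l)"
    "inj_on (\<lambda>(lam, s, t). a lam s t) (cell_index \<Lambda> T)"
    "\<not> module.dependent scale (cell_basis_set \<Lambda> T a)"
    using cellular unfolding cellular_basis_def unital_algebra_def by blast+
  interpret module scale by (rule *(1))
  show "free_family scale (cell_index \<Lambda> T) (\<lambda>(l, s, t). a l s t)"
    using * by unfold_locales (auto simp: cell_index_def cell_basis_set_def)
qed

context cellular_algebra
begin

abbreviation star :: "'a \<Rightarrow> 'a" where "star \<equiv> cell_star scale \<Lambda> T a"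

abbreviation higher :: "'l \<Rightarrow> 'a set" where "higher \<equiv> cell_higher scale \<Lambda> T a"

lemma free_basis: "free_family scale (cell_index \<Lambda> T) (\<lambda>(l, s, t). a l s t)"
  by (rule free_family_axioms)

lemma finite_shapes: "finite \<Lambda>" and finite_tableaux: "l \<in> \<Lambda> \<Longrightarrow> finite (T l)"
  using cellular by (auto simp: cellular_basis_def)

lemma span_basis: "span (cell_basis_set \<Lambda> T a) = UNIV"
  using cellular by (auto simp: cellular_basis_def)

lemma in_span_basis [simp]: "x \<in> span ((\<lambda>(l, s, t). a l s t) ` cell_index \<Lambda> T)"
  using span_basis by (simp add: cell_basis_set_def)

lemma scale_mult_left: "(r *s x) * y = r *s (x * y)"
  and scale_mult_right: "x * (r *s y) = r *s (x * y)"
  and unit_left [simp]: "e * x = x" and unit_right [simp]: "x * e = x"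
proof -
  have "\<forall>r x y. r *s (x * y) = r *s x * y \<and> r *s (x * y) = x * r *s y" "\<forall>x. e * x = x \<and> x * e = x"
    using cellular unfolding cellular_basis_def unital_algebra_def by blast+
  then show "(r *s x) * y = r *s (x * y)" "x * (r *s y) = r *s (x * y)" "e * x = x" "x * e = x"
    by metis+
qed

lemma mult_left_hom: "module_hom scale scale (\<lambda>x. y * x)"
  and mult_right_hom: "module_hom scale scale (\<lambda>x. x * y)"
  by (unfold_locales; simp add: distrib_left distrib_right scale_mult_left scale_mult_right)+

lemma star_add: "star (x + y) = star x + star y"
  and star_scale: "star (r *s x) = r *s star x"
  using cell_star_hom[OF free_basis] span_basis by simp_all

lemma star_basis: "l \<in> \<Lambda> \<Longrightarrow> s \<in> T l \<Longrightarrow> t \<in> T l \<Longrightarrow> star (a l s t) = a l t s"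
  using cell_star_basis[OF free_basis] by simp

lemma star_hom: "module_hom scale scale star"
  by unfold_locales (simp_all add: star_add star_scale)

lemma star_star [simp]: "star (star x) = x"
  using cell_star_involution[OF free_basis] span_basis by simp

lemma star_mult: "star (x * y) = star y * star x"
  using cellular by (auto simp: cellular_basis_def)

lemma star_unit: "star e = e"
  by (metis star_mult star_star unit_left)

lemma basis_induct:
  assumes "subspace V" and "\<And>l s t. l \<in> \<Lambda> \<Longrightarrow> s \<in> T l \<Longrightarrow> t \<in> T l \<Longrightarrow> a l s t \<in> V"
  shows "x \<in> V"
proof -
  have "cell_basis_set \<Lambda> T a \<subseteq> V"
    using assms(2) by (auto simp: cell_basis_set_def cell_index_def)
  from span_minimal[OF this assms(1)] show ?thesis using span_basis by auto
qed

lemma higher_eq: "higher l = span ((\<lambda>(l, s, t). a l s t) ` {(m, u, v) \<in> cell_index \<Lambda> T. l < m})"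
  unfolding cell_higher_def cell_index_def
  by (rule arg_cong[where f = span]) (auto simp: image_iff; force)

lemma higher_iff: "x \<in> higher l \<longleftrightarrow> (\<forall>(m, u, v)\<in>cell_index \<Lambda> T. \<not> l < m \<longrightarrow> coord x (m, u, v) = 0)"
  unfolding higher_eq by (subst span_subfamily_iff) auto

lemma subspace_higher: "subspace (higher l)"
  unfolding cell_higher_def by simp

lemmas higher_simps = subspace_add[OF subspace_higher] subspace_scale[OF subspace_higher]
  subspace_diff[OF subspace_higher] subspace_sum[OF subspace_higher] subspace_0[OF subspace_higher]

lemma basis_in_higher: "m \<in> \<Lambda> \<Longrightarrow> l < m \<Longrightarrow> u \<in> T m \<Longrightarrow> v \<in> T m \<Longrightarrow> a m u v \<in> higher l"
  unfolding cell_higher_def by (rule span_base) blast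

lemma higher_mono: "l \<le> m \<Longrightarrow> higher m \<subseteq> higher l"
  unfolding cell_higher_def by (rule span_mono) (blast intro: le_less_trans)

lemma higher_subset_subspace:
  assumes "subspace V"
    and "\<And>m u v. m \<in> \<Lambda> \<Longrightarrow> l < m \<Longrightarrow> u \<in> T m \<Longrightarrow> v \<in> T m \<Longrightarrow> a m u v \<in> V"
  shows "higher l \<subseteq> V"
  unfolding cell_higher_def using assms by (intro span_minimal) auto

text \<open>
  The matrix of right multiplication by \<open>x\<close> on the cell module of \<open>l\<close>. It is read off from the row
  \<open>a l t\<close>, a row that exists for every \<open>t\<close>; by the cellular axiom all rows give the same matrix.
\<close>
definition cell_matrix :: "'l \<Rightarrow> 'a \<Rightarrow> 't \<Rightarrow> 't \<Rightarrow> 'r" where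
  "cell_matrix l x t v = coord (a l t t * x) (l, t, v)"

lemma coord_cell:
  assumes "y - (\<Sum>v\<in>T l. r v *s a l s v) \<in> higher l" and l: "l \<in> \<Lambda>" "s \<in> T l" "v \<in> T l"
  shows "coord y (l, s, v) = r v"
proof -
  have i: "(l, s, w) \<in> cell_index \<Lambda> T" if "w \<in> T l" for w using l that by (simp add: cell_index_def)
  have "coord (y - (\<Sum>w\<in>T l. r w *s a l s w)) (l, s, v) = 0"
    using assms(1) i[OF l(3)] by (auto simp: higher_iff)
  then have "coord y (l, s, v) = coord (\<Sum>w\<in>T l. r w *s a l s w) (l, s, v)"
    using i[OF l(3)] by (simp add: coord_diff)
  also have "\<dots> = (\<Sum>w\<in>T l. r w * coord (a l s w) (l, s, v))"
    using i[OF l(3)] by (simp add: coord_sum coord_scale)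
  also have "\<dots> = (\<Sum>w\<in>T l. if w = v then r v else 0)"
  proof (rule sum.cong[OF refl])
    fix w assume w: "w \<in> T l"
    show "r w * coord (a l s w) (l, s, v) = (if w = v then r v else 0)"
      using coord_family[OF i[OF w] i[OF l(3)]] by auto
  qed
  also have "\<dots> = r v" using l finite_tableaux by simp
  finally show ?thesis .
qed

lemma right_action:
  assumes l: "l \<in> \<Lambda>" "s \<in> T l" "t \<in> T l"
  shows "a l s t * x - (\<Sum>v\<in>T l. cell_matrix l x t v *s a l s v) \<in> higher l"
proof -
  obtain r where r: "\<And>s. s \<in> T l \<Longrightarrow> a l s t * x - (\<Sum>v\<in>T l. r v *s a l s v) \<in> higher l"
    using cellular l unfolding cellular_basis_def by blast
  have "cell_matrix l x t v = r v" if "v \<in> T l" for v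
    unfolding cell_matrix_def using coord_cell[OF r[OF l(3)] l(1,3) that] .
  then show ?thesis using r[OF l(2)] by simp
qed

lemma cell_matrix_unique:
  assumes "l \<in> \<Lambda>" "t \<in> T l" "v \<in> T l"
    and "a l t t * x - (\<Sum>v\<in>T l. r v *s a l t v) \<in> higher l"
  shows "cell_matrix l x t v = r v"
  unfolding cell_matrix_def using coord_cell[OF assms(4,1,2,3)] .

lemma higher_right_ideal: "x \<in> higher l \<Longrightarrow> x * y \<in> higher l"
proof -
  interpret R: module_hom scale scale "\<lambda>x. x * y" by (rule mult_right_hom)
  have "higher l \<subseteq> {x. x * y \<in> higher l}"
  proof (rule higher_subset_subspace)
    show "subspace {x. x * y \<in> higher l}"
      using R.subspace_linear_preimage[OF subspace_higher] .
    fix m u v assume m: "m \<in> \<Lambda>" "l < m" "u \<in> T m" "v \<in> T m"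
    have "a m u v * y - (\<Sum>w\<in>T m. cell_matrix m y v w *s a m u w) \<in> higher l"
      using right_action[OF m(1,3,4)] higher_mono[OF less_imp_le[OF m(2)]] by blast
    moreover have "(\<Sum>w\<in>T m. cell_matrix m y v w *s a m u w) \<in> higher l"
      using m by (intro higher_simps basis_in_higher) auto
    ultimately have "a m u v * y - (\<Sum>w\<in>T m. cell_matrix m y v w *s a m u w)
        + (\<Sum>w\<in>T m. cell_matrix m y v w *s a m u w) \<in> higher l"
      by (rule higher_simps)
    then show "a m u v \<in> {x. x * y \<in> higher l}" by simp
  qed
  then show "x \<in> higher l \<Longrightarrow> x * y \<in> higher l" by blast
qed

lemma star_higher: "x \<in> higher l \<Longrightarrow> star x \<in> higher l"
proof -
  interpret S: module_hom scale scale star by (rule star_hom)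
  have "higher l \<subseteq> {x. star x \<in> higher l}"
    by (rule higher_subset_subspace[OF S.subspace_linear_preimage[OF subspace_higher]])
      (simp add: star_basis basis_in_higher)
  then show "x \<in> higher l \<Longrightarrow> star x \<in> higher l" by blast
qed

lemma higher_left_ideal: "x \<in> higher l \<Longrightarrow> y * x \<in> higher l"
  using star_higher[OF higher_right_ideal[OF star_higher], of x l "star y"] by (simp add: star_mult)

lemma
  assumes l: "l \<in> \<Lambda>" "t \<in> T l" "v \<in> T l"
  shows cell_matrix_add: "cell_matrix l (x + y) t v = cell_matrix l x t v + cell_matrix l y t v"
    and cell_matrix_scale: "cell_matrix l (r *s x) t v = r * cell_matrix l x t v"
    and cell_matrix_unit: "cell_matrix l e t v = (if t = v then 1 else 0)"
proof -
  have i: "(l, t, t) \<in> cell_index \<Lambda> T" "(l, t, v) \<in> cell_index \<Lambda> T"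
    using l by (simp_all add: cell_index_def)
  show "cell_matrix l (x + y) t v = cell_matrix l x t v + cell_matrix l y t v"
    "cell_matrix l (r *s x) t v = r * cell_matrix l x t v"
    using i by (simp_all add: cell_matrix_def distrib_left coord_add scale_mult_right coord_scale)
  show "cell_matrix l e t v = (if t = v then 1 else 0)"
    using coord_family[OF i] by (auto simp: cell_matrix_def)
qed

lemma cell_matrix_mult:
  assumes l: "l \<in> \<Lambda>" "t \<in> T l" "v \<in> T l"
  shows "cell_matrix l (x * y) t v = (\<Sum>w\<in>T l. cell_matrix l x t w * cell_matrix l y w v)"
proof (rule cell_matrix_unique[OF l])
  let ?X = "\<Sum>w\<in>T l. cell_matrix l x t w *s a l t w"
  let ?Y = "\<lambda>w. \<Sum>v\<in>T l. cell_matrix l y w v *s a l t v"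
  have "(a l t t * x - ?X) * y \<in> higher l"
    by (intro higher_right_ideal right_action l)
  moreover have "(\<Sum>w\<in>T l. cell_matrix l x t w *s (a l t w * y - ?Y w)) \<in> higher l"
    by (intro higher_simps right_action l)
  ultimately have "(a l t t * x - ?X) * y +
      (\<Sum>w\<in>T l. cell_matrix l x t w *s (a l t w * y - ?Y w)) \<in> higher l"
    by (rule higher_simps)
  also have "(a l t t * x - ?X) * y + (\<Sum>w\<in>T l. cell_matrix l x t w *s (a l t w * y - ?Y w)) =
      a l t t * (x * y) - (\<Sum>w\<in>T l. cell_matrix l x t w *s ?Y w)"
    by (simp add: left_diff_distrib sum_distrib_right scale_mult_left scale_right_diff_distrib
      sum_subtractf mult.assoc)
  also have "(\<Sum>w\<in>T l. cell_matrix l x t w *s ?Y w) =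
      (\<Sum>v\<in>T l. (\<Sum>w\<in>T l. cell_matrix l x t w * cell_matrix l y w v) *s a l t v)"
    by (simp add: scale_sum_right scale_sum_left) (rule sum.swap)
  finally show "a l t t * (x * y) -
      (\<Sum>v\<in>T l. (\<Sum>w\<in>T l. cell_matrix l x t w * cell_matrix l y w v) *s a l t v) \<in> higher l" .
qed

lemma coord_of_cell:
  assumes y: "y - (\<Sum>v\<in>T l. r v *s a l s v) \<in> higher l" and l: "l \<in> \<Lambda>" "s \<in> T l"
    and j: "(m, u, w) \<in> cell_index \<Lambda> T" and nz: "coord y (m, u, w) \<noteq> 0"
  shows "l < m \<or> m = l \<and> u = s \<and> r w \<noteq> 0"
proof (rule ccontr)
  assume not: "\<not> ?thesis"
  then have "coord (y - (\<Sum>v\<in>T l. r v *s a l s v)) (m, u, w) = 0"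
    using y j by (auto simp: higher_iff)
  then have "coord y (m, u, w) = (\<Sum>v\<in>T l. r v * coord (a l s v) (m, u, w))"
    using j by (simp add: coord_diff coord_sum coord_scale)
  also have "\<dots> = 0"
  proof (rule sum.neutral, rule ballI)
    fix v assume "v \<in> T l"
    then have "(l, s, v) \<in> cell_index \<Lambda> T" using l by (simp add: cell_index_def)
    from coord_family[OF this j] show "r v * coord (a l s v) (m, u, w) = 0"
      using not by auto
  qed
  finally show False using nz by simp
qed

end

section \<open>Cellular algebras with mutually annihilating blocks\<close>

locale cellular_blocks = cellular_algebra scale e \<Lambda> T a
  for scale :: "'r::comm_ring_1 \<Rightarrow> 'a::ring \<Rightarrow> 'a" (infixr \<open>*s\<close> 75)
    and e \<Lambda> and T :: "'l::order \<Rightarrow> 't set" and a +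
  fixes \<P> :: "'l set set"
  assumes cover: "\<Union>\<P> = \<Lambda>"
    and disjoint: "\<Gamma> \<in> \<P> \<Longrightarrow> \<Gamma>' \<in> \<P> \<Longrightarrow> \<Gamma> \<noteq> \<Gamma>' \<Longrightarrow> \<Gamma> \<inter> \<Gamma>' = {}"
    and annihilate: "\<Gamma> \<in> \<P> \<Longrightarrow> \<Gamma>' \<in> \<P> \<Longrightarrow> \<Gamma> \<noteq> \<Gamma>' \<Longrightarrow> l \<in> \<Gamma> \<Longrightarrow> m \<in> \<Gamma>' \<Longrightarrow>
      s \<in> T l \<Longrightarrow> t \<in> T l \<Longrightarrow> u \<in> T m \<Longrightarrow> v \<in> T m \<Longrightarrow> a l s t * a m u v = 0"
begin

abbreviation block :: "'l set \<Rightarrow> 'a set" where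
  "block \<Gamma> \<equiv> span ((\<lambda>(l, s, t). a l s t) ` cell_index \<Gamma> T)"

definition block_part :: "'l set \<Rightarrow> 'a \<Rightarrow> 'a" where
  "block_part \<Gamma> x = (\<Sum>j\<in>cell_index \<Gamma> T. coord x j *s (\<lambda>(l, s, t). a l s t) j)"

lemma block_index: "\<Gamma> \<in> \<P> \<Longrightarrow> cell_index \<Gamma> T \<subseteq> cell_index \<Lambda> T"
  using cover by (auto simp: cell_index_def)

lemma finite_blocks: "finite \<P>"
  using cover finite_shapes by (auto intro: finite_UnionD)

lemma block_part_in: "block_part \<Gamma> x \<in> block \<Gamma>"
  unfolding block_part_def by (rule in_span_sum)

lemma block_iff: "\<Gamma> \<in> \<P> \<Longrightarrow> x \<in> block \<Gamma> \<longleftrightarrow> (\<forall>j\<in>cell_index \<Lambda> T - cell_index \<Gamma> T. coord x j = 0)"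
  by (rule span_subfamily_iff) (simp_all add: block_index)

lemma sum_block_part: "(\<Sum>\<Gamma>\<in>\<P>. block_part \<Gamma> x) = x"
proof -
  have "(\<Union>\<Gamma>\<in>\<P>. cell_index \<Gamma> T) = cell_index \<Lambda> T"
    using cover by (auto simp: cell_index_def)
  then have "x = (\<Sum>j\<in>(\<Union>\<Gamma>\<in>\<P>. cell_index \<Gamma> T). coord x j *s (\<lambda>(l, s, t). a l s t) j)"
    using sum_coord[of x] by simp
  also have "\<dots> = (\<Sum>\<Gamma>\<in>\<P>. block_part \<Gamma> x)"
    unfolding block_part_def
  proof (rule sum.UNION_disjoint[OF finite_blocks])
    show "\<forall>\<Gamma>\<in>\<P>. finite (cell_index \<Gamma> T)"
      using block_index finite_index finite_subset by blast
    show "\<forall>\<Gamma>\<in>\<P>. \<forall>\<Gamma>'\<in>\<P>. \<Gamma> \<noteq> \<Gamma>' \<longrightarrow> cell_index \<Gamma> T \<inter> cell_index \<Gamma>' T = {}"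
      using disjoint by (auto simp: cell_index_def)
  qed
  finally show ?thesis by simp
qed

lemma block_part_self:
  assumes "\<Gamma> \<in> \<P>" "x \<in> block \<Gamma>"
  shows "block_part \<Gamma> x = x"
proof -
  have "block_part \<Gamma> x = (\<Sum>j\<in>cell_index \<Lambda> T. coord x j *s (\<lambda>(l, s, t). a l s t) j)"
    unfolding block_part_def using assms block_index finite_index
    by (intro sum.mono_neutral_left) (auto simp: block_iff)
  then show ?thesis using sum_coord[of x] by simp
qed

lemma block_part_other:
  assumes "\<Gamma> \<in> \<P>" "\<Gamma>' \<in> \<P>" "\<Gamma> \<noteq> \<Gamma>'" "x \<in> block \<Gamma>'"
  shows "block_part \<Gamma> x = 0"
  unfolding block_part_def
proof (rule sum.neutral, rule ballI)
  fix j assume j: "j \<in> cell_index \<Gamma> T"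
  moreover have "j \<notin> cell_index \<Gamma>' T"
    using j disjoint[OF assms(1-3)] by (auto simp: cell_index_def)
  ultimately have "coord x j = 0"
    using assms block_index by (auto simp: block_iff)
  then show "coord x j *s (\<lambda>(l, s, t). a l s t) j = 0" by simp
qed

lemma block_part_sum: "\<Gamma> \<in> \<P> \<Longrightarrow> block_part \<Gamma> (sum f J) = (\<Sum>j\<in>J. block_part \<Gamma> (f j))"
  unfolding block_part_def using block_index[of \<Gamma>]
  by (subst sum.swap) (auto simp: coord_sum scale_sum_left intro!: sum.cong)

lemma block_mult_zero:
  assumes \<Gamma>: "\<Gamma> \<in> \<P>" "\<Gamma>' \<in> \<P>" "\<Gamma> \<noteq> \<Gamma>'" and x: "x \<in> block \<Gamma>" and y: "y \<in> block \<Gamma>'"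
  shows "x * y = 0"
proof -
  have "(\<lambda>(l, s, t). a l s t) ` cell_index \<Gamma>' T \<subseteq> {y. a l s t * y = 0}"
    if "l \<in> \<Gamma>" "s \<in> T l" "t \<in> T l" for l s t
    using annihilate[OF \<Gamma> that(1) _ that(2,3)] by (auto simp: cell_index_def)
  from span_minimal[OF this module_hom.subspace_kernel[OF mult_left_hom]]
  have "(\<lambda>(l, s, t). a l s t) ` cell_index \<Gamma> T \<subseteq> {x. x * y = 0}"
    using y by (auto simp: cell_index_def)
  from span_minimal[OF this module_hom.subspace_kernel[OF mult_right_hom]]
  show ?thesis using x by auto
qed

lemma block_unit:
  assumes \<Gamma>: "\<Gamma> \<in> \<P>" and x: "x \<in> block \<Gamma>"
  shows "x * block_part \<Gamma> e = x" "block_part \<Gamma> e * x = x"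
proof -
  have "x = x * (\<Sum>\<Gamma>'\<in>\<P>. block_part \<Gamma>' e)" by (simp add: sum_block_part)
  also have "\<dots> = x * block_part \<Gamma> e + (\<Sum>\<Gamma>'\<in>\<P> - {\<Gamma>}. x * block_part \<Gamma>' e)"
    using \<Gamma> finite_blocks by (simp add: sum.remove distrib_left sum_distrib_left)
  also have "(\<Sum>\<Gamma>'\<in>\<P> - {\<Gamma>}. x * block_part \<Gamma>' e) = 0"
    using block_mult_zero[OF \<Gamma> _ _ x block_part_in] by (intro sum.neutral) auto
  finally show "x * block_part \<Gamma> e = x" by simp
  have "x = (\<Sum>\<Gamma>'\<in>\<P>. block_part \<Gamma>' e) * x" by (simp add: sum_block_part)
  also have "\<dots> = block_part \<Gamma> e * x + (\<Sum>\<Gamma>'\<in>\<P> - {\<Gamma>}. block_part \<Gamma>' e * x)"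
    using \<Gamma> finite_blocks by (simp add: sum.remove distrib_right sum_distrib_right)
  also have "(\<Sum>\<Gamma>'\<in>\<P> - {\<Gamma>}. block_part \<Gamma>' e * x) = 0"
    using block_mult_zero[OF _ \<Gamma> _ block_part_in x] by (intro sum.neutral) auto
  finally show "block_part \<Gamma> e * x = x" by simp
qed

text \<open>
  The component of \<open>x * y\<close> in another block is obtained by multiplying with the component of the
  unit there, which already annihilates \<open>x\<close>.
\<close>
lemma block_mult_closed:
  assumes \<Gamma>: "\<Gamma> \<in> \<P>" and x: "x \<in> block \<Gamma>"
  shows "x * y \<in> block \<Gamma>"
proof -
  have "block_part \<Gamma>' (x * y) = 0" if "\<Gamma>' \<in> \<P> - {\<Gamma>}" for \<Gamma>'
  proof -
    have "block_part \<Gamma>' (x * y) = block_part \<Gamma>' e * block_part \<Gamma>' (x * y)"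
      using block_unit(2)[of \<Gamma>', OF _ block_part_in] that by simp
    also have "\<dots> = (\<Sum>\<Delta>\<in>\<P>. block_part \<Gamma>' e * block_part \<Delta> (x * y))"
      using that finite_blocks block_mult_zero[of \<Gamma>', OF _ _ _ block_part_in block_part_in]
      by (subst sum.remove[of _ \<Gamma>']) (auto intro!: sum.neutral)
    also have "\<dots> = block_part \<Gamma>' e * x * y"
      by (simp add: sum_distrib_left[symmetric] sum_block_part mult.assoc)
    also have "block_part \<Gamma>' e * x = 0"
      using that by (intro block_mult_zero[OF _ \<Gamma> _ block_part_in x]) auto
    finally show ?thesis by simp
  qed
  then have "x * y = block_part \<Gamma> (x * y)"
    using sum_block_part[of "x * y"] \<Gamma> finite_blocks by (simp add: sum.remove)
  then show ?thesis using block_part_in[of \<Gamma> "x * y"] by simp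
qed

text \<open>
  The unit of a block is the component of the unit of the algebra, and its cellular structure is inherited:
  the error terms of the cellular axiom lie both in the block and in higher cells, hence in
  the higher cells of the block.
\<close>
lemma block_cellular:
  assumes \<Gamma>: "\<Gamma> \<in> \<P>"
  shows "\<exists>e. cellular_basis scale (linkage_component scale T a \<Gamma>) e \<Gamma> T a"
proof
  have sub: "\<Gamma> \<subseteq> \<Lambda>" using \<Gamma> cover by auto
  have comp: "linkage_component scale T a \<Gamma> = block \<Gamma>"
    by (simp add: linkage_component_def cell_basis_set_def)
  have fam\<Gamma>: "free_family scale (cell_index \<Gamma> T) (\<lambda>(l, s, t). a l s t)"
  proof unfold_locales
    show "finite (cell_index \<Gamma> T)" using block_index[OF \<Gamma>] finite_index by (rule finite_subset)
    show "inj_on (\<lambda>(l, s, t). a l s t) (cell_index \<Gamma> T)"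
      using inj_family block_index[OF \<Gamma>] by (rule inj_on_subset)
    show "independent ((\<lambda>(l, s, t). a l s t) ` cell_index \<Gamma> T)"
      using independent_family image_mono[OF block_index[OF \<Gamma>]] by (rule independent_mono)
  qed
  have star: "cell_star scale \<Gamma> T a x = star x" if "x \<in> block \<Gamma>" for x
    using that sub by (intro cell_star_eqI[OF fam\<Gamma> star_hom]) (auto simp: star_basis cell_basis_set_def)
  have base: "a l s t \<in> block \<Gamma>" if "l \<in> \<Gamma>" "s \<in> T l" "t \<in> T l" for l s t
  proof -
    have "(l, s, t) \<in> cell_index \<Gamma> T" using that by (simp add: cell_index_def)
    from span_base[OF imageI[OF this, of "\<lambda>(l, s, t). a l s t"]] show ?thesis by simp
  qed
  show "cellular_basis scale (linkage_component scale T a \<Gamma>) (block_part \<Gamma> e) \<Gamma> T a"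
    unfolding comp
  proof (rule cellular_basisI[OF _ _ _ fam\<Gamma>])
    show "unital_algebra scale (block \<Gamma>) (block_part \<Gamma> e)"
      unfolding unital_algebra_def
      using block_mult_closed[OF \<Gamma>] block_unit[OF \<Gamma>] block_part_in module_axioms
      by (simp add: scale_mult_left scale_mult_right)
    show "finite \<Gamma>" using sub finite_shapes by (rule finite_subset)
    show "finite (T l)" if "l \<in> \<Gamma>" for l using that sub finite_tableaux by auto
    show "span (cell_basis_set \<Gamma> T a) = block \<Gamma>" by (simp add: cell_basis_set_def)
  next
    fix x l t assume x: "x \<in> block \<Gamma>" and l: "l \<in> \<Gamma>" "t \<in> T l"
    have hi: "cell_higher scale \<Gamma> T a l =
        span ((\<lambda>(l, s, t). a l s t) ` {(m, u, v) \<in> cell_index \<Gamma> T. l < m})"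
      unfolding cell_higher_def cell_index_def
      by (rule arg_cong[where f = span]) (auto simp: image_iff; force)
    have "a l s t * x - (\<Sum>v\<in>T l. cell_matrix l x t v *s a l s v) \<in> cell_higher scale \<Gamma> T a l"
      (is "?y \<in> _") if s: "s \<in> T l" for s
    proof -
      have "?y \<in> higher l" using l s sub by (intro right_action) auto
      moreover have "?y \<in> block \<Gamma>"
        using l s by (intro span_diff block_mult_closed[OF \<Gamma>] span_sum span_scale base)
      ultimately show ?thesis
        unfolding hi using block_index[OF \<Gamma>]
        by (subst span_subfamily_iff) (auto simp: block_iff[OF \<Gamma>] higher_iff)
    qed
    then show "\<exists>r. \<forall>s\<in>T l. a l s t * x - (\<Sum>v\<in>T l. r v *s a l s v) \<in> cell_higher scale \<Gamma> T a l"
      by blast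
  next
    fix x y assume "x \<in> block \<Gamma>" "y \<in> block \<Gamma>"
    then show "cell_star scale \<Gamma> T a (x * y) = cell_star scale \<Gamma> T a y * cell_star scale \<Gamma> T a x"
      by (simp add: star block_mult_closed[OF \<Gamma>] star_mult)
  qed
qed

lemma block_direct_sum: "algebra_direct_sum UNIV \<P> (linkage_component scale T a)"
proof -
  have comp: "linkage_component scale T a = block"
    by (simp add: fun_eq_iff linkage_component_def cell_basis_set_def)
  have "\<exists>!y. y \<in> (\<Pi>\<^sub>E \<Gamma>\<in>\<P>. block \<Gamma>) \<and> x = (\<Sum>\<Gamma>\<in>\<P>. y \<Gamma>)" for x
  proof (rule ex1I[of _ "restrict (\<lambda>\<Gamma>. block_part \<Gamma> x) \<P>"], intro conjI)
    show "restrict (\<lambda>\<Gamma>. block_part \<Gamma> x) \<P> \<in> (\<Pi>\<^sub>E \<Gamma>\<in>\<P>. block \<Gamma>)"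
      using block_part_in by auto
    show "x = (\<Sum>\<Gamma>\<in>\<P>. restrict (\<lambda>\<Gamma>. block_part \<Gamma> x) \<P> \<Gamma>)"
      by (simp add: sum_block_part)
  next
    fix y assume y: "y \<in> (\<Pi>\<^sub>E \<Gamma>\<in>\<P>. block \<Gamma>) \<and> x = (\<Sum>\<Gamma>\<in>\<P>. y \<Gamma>)"
    have "block_part \<Gamma> x = y \<Gamma>" if \<Gamma>: "\<Gamma> \<in> \<P>" for \<Gamma>
    proof -
      have mem: "y \<Gamma>' \<in> block \<Gamma>'" if "\<Gamma>' \<in> \<P>" for \<Gamma>' using y that by auto
      have "block_part \<Gamma> x = (\<Sum>\<Gamma>'\<in>\<P>. block_part \<Gamma> (y \<Gamma>'))"
        using y block_part_sum[OF \<Gamma>, of y \<P>] by simp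
      also have "\<dots> = (\<Sum>\<Gamma>'\<in>\<P>. if \<Gamma>' = \<Gamma> then y \<Gamma> else 0)"
        using block_part_self[OF \<Gamma> mem[OF \<Gamma>]] block_part_other[OF \<Gamma> _ _ mem]
        by (intro sum.cong) auto
      also have "\<dots> = y \<Gamma>" using \<Gamma> finite_blocks by simp
      finally show ?thesis .
    qed
    then show "y = restrict (\<lambda>\<Gamma>. block_part \<Gamma> x) \<P>"
      using y by (intro PiE_ext[of y \<P> block]) (auto simp: block_part_in)
  qed
  then show ?thesis
    unfolding algebra_direct_sum_def comp using block_mult_zero by blast
qed

end

section \<open>Polynomials in the Jucys-Murphy elements\<close>

text \<open>
  The element \<open>x\<close> is a polynomial in the \<open>L i\<close>, and \<open>f p\<close> is the value of this polynomial when the contents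
  of \<open>p\<close> are substituted. This is a relation rather than a map from value functions to elements,
  because over the residue field different elements can have the same values.
\<close>
inductive jm_poly ::
  "('r::comm_ring_1 \<Rightarrow> 'a::ring \<Rightarrow> 'a) \<Rightarrow> 'a \<Rightarrow> nat \<Rightarrow> (nat \<Rightarrow> 'a) \<Rightarrow> ('p \<Rightarrow> nat \<Rightarrow> 'r) \<Rightarrow>
   'a \<Rightarrow> ('p \<Rightarrow> 'r) \<Rightarrow> bool"
  for scale e M L c where
  const: "jm_poly scale e M L c (scale r e) (\<lambda>_. r)"
| gen: "i \<in> {1..M} \<Longrightarrow> jm_poly scale e M L c (L i) (\<lambda>t. c t i)"
| add: "jm_poly scale e M L c x f \<Longrightarrow> jm_poly scale e M L c y g \<Longrightarrow>
    jm_poly scale e M L c (x + y) (\<lambda>t. f t + g t)"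
| mult: "jm_poly scale e M L c x f \<Longrightarrow> jm_poly scale e M L c y g \<Longrightarrow>
    jm_poly scale e M L c (x * y) (\<lambda>t. f t * g t)"

locale jucys_murphy = cellular_algebra scale e \<Lambda> T a
  for scale :: "'r::comm_ring_1 \<Rightarrow> 'a::ring \<Rightarrow> 'a" (infixr \<open>*s\<close> 75)
    and e \<Lambda> and T :: "'l::order \<Rightarrow> 't set" and a +
  fixes tgt :: "'l \<Rightarrow> 't \<Rightarrow> 't \<Rightarrow> bool" and M :: nat and L :: "nat \<Rightarrow> 'a"
    and c :: "'l \<times> 't \<Rightarrow> nat \<Rightarrow> 'r"
  assumes order: "\<And>l. l \<in> \<Lambda> \<Longrightarrow> irreflp_on (T l) (tgt l) \<and> transp_on (T l) (tgt l)"
    and jm: "jm_family scale \<Lambda> T tgt a M L c"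
begin

lemma tgt_irrefl: "l \<in> \<Lambda> \<Longrightarrow> t \<in> T l \<Longrightarrow> \<not> tgt l t t"
  using order by (auto simp: irreflp_on_def)

lemma tgt_trans: "l \<in> \<Lambda> \<Longrightarrow> s \<in> T l \<Longrightarrow> t \<in> T l \<Longrightarrow> u \<in> T l \<Longrightarrow> tgt l s t \<Longrightarrow> tgt l t u \<Longrightarrow> tgt l s u"
  using order unfolding transp_on_def by blast

abbreviation poly :: "'a \<Rightarrow> ('l \<times> 't \<Rightarrow> 'r) \<Rightarrow> bool" where
  "poly \<equiv> jm_poly scale e M L c"

lemma poly_scale: "poly x f \<Longrightarrow> poly (r *s x) (\<lambda>t. r * f t)"
  using jm_poly.mult[OF jm_poly.const[of scale e M L c r]] by (simp add: scale_mult_left)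

lemma poly_diff: "poly x f \<Longrightarrow> poly y g \<Longrightarrow> poly (x - y) (\<lambda>t. f t - g t)"
  using jm_poly.add[OF _ poly_scale[of y g "- 1"]] by simp

lemma poly_unit: "poly e (\<lambda>_. 1)"
  using jm_poly.const[of scale e M L c 1] by simp

lemma poly_zero: "poly 0 (\<lambda>_. 0)"
  using jm_poly.const[of scale e M L c 0] by simp

lemma poly_sum: "(\<And>j. j \<in> J \<Longrightarrow> poly (x j) (f j)) \<Longrightarrow> poly (sum x J) (\<lambda>t. \<Sum>j\<in>J. f j t)"
  by (induction J rule: infinite_finite_induct) (auto simp: poly_zero intro: jm_poly.add)

text \<open>
  Interpolation needs only the existence of an element with the product as value function; so no
  order has to be fixed for the factors in the algebra.
\<close>
lemma ex_poly_prod: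
  "(\<And>j. j \<in> J \<Longrightarrow> \<exists>x. poly x (f j)) \<Longrightarrow> \<exists>x. poly x (\<lambda>t. \<Prod>j\<in>J. f j t)"
proof (induction J rule: infinite_finite_induct)
  case (insert j J)
  obtain x where x: "poly x (f j)" using insert.prems by blast
  obtain y where y: "poly y (\<lambda>t. \<Prod>j\<in>J. f j t)" using insert.IH insert.prems by blast
  from jm_poly.mult[OF x y] insert.hyps show ?case by auto
qed (auto intro: poly_unit)

lemma poly_commute_gen:
  assumes "poly x f" and i: "i \<in> {1..M}"
  shows "x * L i = L i * x"
  using assms(1)
proof induction
  case (gen j)
  then show ?case using jm i by (auto simp: jm_family_def)
next
  case (mult x f y g)
  then show ?case by (metis mult.assoc)
qed (simp_all add: scale_mult_left scale_mult_right distrib_left distrib_right)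

lemma poly_commute:
  assumes "poly x f" and y: "poly y g"
  shows "x * y = y * x"
  using assms(1)
proof induction
  case (gen j)
  then show ?case using poly_commute_gen[OF y] by simp
next
  case (mult x f z g)
  then show ?case by (metis mult.assoc)
qed (simp_all add: scale_mult_left scale_mult_right distrib_left distrib_right)

lemma poly_star: "poly x f \<Longrightarrow> star x = x"
proof (induction rule: jm_poly.induct)
  case (gen j)
  then show ?case using jm by (auto simp: jm_family_def)
next
  case (mult x f y g)
  then show ?case using poly_commute[of x f y g] by (simp add: star_mult)
qed (simp_all add: star_scale star_add star_unit)

lemma cell_matrix_gen:
  assumes i: "i \<in> {1..M}" and l: "l \<in> \<Lambda>" "t \<in> T l" "v \<in> T l"
  shows "v = t \<Longrightarrow> cell_matrix l (L i) t v = c (l, t) i"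
    and "v \<noteq> t \<Longrightarrow> \<not> tgt l v t \<Longrightarrow> cell_matrix l (L i) t v = 0"
proof -
  obtain r where r: "a l t t * L i -
      (c (l, t) i *s a l t t + (\<Sum>v | v \<in> T l \<and> tgt l v t. r v *s a l t v)) \<in> higher l"
    using jm i l unfolding jm_family_def by blast
  let ?q = "\<lambda>v. if v = t then c (l, t) i else if tgt l v t then r v else 0"
  have "(\<Sum>v\<in>T l. ?q v *s a l t v) =
      c (l, t) i *s a l t t + (\<Sum>v\<in>T l - {t}. if tgt l v t then r v *s a l t v else 0)"
    using l finite_tableaux by (subst sum.remove[of _ t]) (auto intro!: sum.cong split: if_splits)
  also have "(\<Sum>v\<in>T l - {t}. if tgt l v t then r v *s a l t v else 0) =
      (\<Sum>v | v \<in> T l \<and> tgt l v t. r v *s a l t v)"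
    using l finite_tableaux tgt_irrefl by (intro sum.mono_neutral_cong_right) auto
  finally have "cell_matrix l (L i) t v = ?q v"
    using r by (intro cell_matrix_unique[OF l]) simp
  then show "v = t \<Longrightarrow> cell_matrix l (L i) t v = c (l, t) i"
    "v \<noteq> t \<Longrightarrow> \<not> tgt l v t \<Longrightarrow> cell_matrix l (L i) t v = 0" by auto
qed

text \<open>
  Triangular matrices are closed under sums and products, and their diagonals are added and
  multiplied entrywise; so the description of the generators extends to all polynomials.
\<close>
lemma poly_cell_matrix:
  assumes "poly x f" and l: "l \<in> \<Lambda>"
  shows "t \<in> T l \<Longrightarrow> cell_matrix l x t t = f (l, t)"
    and "t \<in> T l \<Longrightarrow> v \<in> T l \<Longrightarrow> v \<noteq> t \<Longrightarrow> \<not> tgt l v t \<Longrightarrow> cell_matrix l x t v = 0"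
proof -
  have "(\<forall>t\<in>T l. cell_matrix l x t t = f (l, t)) \<and>
      (\<forall>t\<in>T l. \<forall>v\<in>T l. v \<noteq> t \<longrightarrow> \<not> tgt l v t \<longrightarrow> cell_matrix l x t v = 0)"
    using assms(1)
  proof induction
    case (const r)
    then show ?case using l by (simp add: cell_matrix_scale cell_matrix_unit)
  next
    case (gen i)
    then show ?case using l by (simp add: cell_matrix_gen)
  next
    case (add x f y g)
    then show ?case using l by (simp add: cell_matrix_add)
  next
    case (mult x f y g)
    have prod0: "cell_matrix l x t w * cell_matrix l y w v = 0"
      if "t \<in> T l" "v \<in> T l" "w \<in> T l" "\<not> (w = t \<and> v = t)" "\<not> tgt l v t" for t v w
      using mult.IH that tgt_trans[OF l, of v w t] by (metis mult_zero_left mult_zero_right)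
    show ?case
    proof (intro conjI ballI impI)
      fix t assume t: "t \<in> T l"
      have "cell_matrix l (x * y) t t = (\<Sum>w\<in>T l. if w = t then f (l, t) * g (l, t) else 0)"
        unfolding cell_matrix_mult[OF l t t]
        using mult.IH prod0[OF t t] t tgt_irrefl[OF l t] by (intro sum.cong) auto
      then show "cell_matrix l (x * y) t t = f (l, t) * g (l, t)"
        using finite_tableaux l t by simp
    next
      fix t v assume "t \<in> T l" "v \<in> T l" "v \<noteq> t" "\<not> tgt l v t"
      then show "cell_matrix l (x * y) t v = 0"
        using prod0[of t v] by (simp add: cell_matrix_mult l)
    qed
  qed
  then show "t \<in> T l \<Longrightarrow> cell_matrix l x t t = f (l, t)"
    "t \<in> T l \<Longrightarrow> v \<in> T l \<Longrightarrow> v \<noteq> t \<Longrightarrow> \<not> tgt l v t \<Longrightarrow> cell_matrix l x t v = 0" by auto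
qed

text \<open>
  Multiplying \<open>a l s t\<close> from the right by a polynomial raises \<open>t\<close> or the cell, multiplying from the left raises \<open>s\<close> or
  the cell. Both operations are triangular for the common order in which \<open>s\<close> and \<open>t\<close> may grow independently.
\<close>
definition above :: "'l \<times> 't \<times> 't \<Rightarrow> 'l \<times> 't \<times> 't \<Rightarrow> bool" where
  "above = (\<lambda>(l, s, t) (m, u, v). l < m \<or>
     l = m \<and> (u = s \<or> tgt l u s) \<and> (v = t \<or> tgt l v t) \<and> (u, v) \<noteq> (s, t))"

lemma above_trans:
  assumes ijk: "i \<in> cell_index \<Lambda> T" "j \<in> cell_index \<Lambda> T" "k \<in> cell_index \<Lambda> T"
    and "above i j" "above j k"
  shows "above i k"
proof -
  obtain l s t m u v n w z where [simp]: "i = (l, s, t)" "j = (m, u, v)" "k = (n, w, z)"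
    using prod_cases3 by metis
  have mem: "l \<in> \<Lambda>" "s \<in> T l" "t \<in> T l" "m \<in> \<Lambda>" "u \<in> T m" "v \<in> T m" "w \<in> T n" "z \<in> T n"
    using ijk by (simp_all add: cell_index_def)
  show "above i k"
  proof (cases "l < n")
    case False
    then have lmn: "m = l" "n = l"
      using \<open>above i j\<close> \<open>above j k\<close> by (auto simp: above_def dest: less_trans)
    have ab: "above (l, s, t) (l, u, v)" "above (l, u, v) (l, w, z)"
      using \<open>above i j\<close> \<open>above j k\<close> by (simp_all add: lmn)
    note mem = mem[unfolded lmn]
    have "w = s \<or> tgt l w s" "z = t \<or> tgt l z t"
      using ab mem tgt_trans[of l w u s] tgt_trans[of l z v t] by (auto simp: above_def)
    moreover have "(w, z) \<noteq> (s, t)"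
    proof
      assume "(w, z) = (s, t)"
      then have "u = s" "v = t"
        using ab mem tgt_trans[of l s u s] tgt_trans[of l t v t] tgt_irrefl[of l s] tgt_irrefl[of l t]
        by (auto simp: above_def)
      then show False using ab by (simp add: above_def)
    qed
    ultimately show ?thesis by (simp add: above_def lmn)
  qed (simp add: above_def)
qed

lemma obtain_height:
  obtains h :: "'l \<times> 't \<times> 't \<Rightarrow> nat" where
    "\<And>i j. i \<in> cell_index \<Lambda> T \<Longrightarrow> j \<in> cell_index \<Lambda> T \<Longrightarrow> above i j \<Longrightarrow> h i < h j"
proof (rule finite_strict_order_height[OF finite_index, of above])
  show "irreflp_on (cell_index \<Lambda> T) above"
    by (auto simp: irreflp_on_def above_def)
  show "transp_on (cell_index \<Lambda> T) above"
    by (rule transp_onI) (rule above_trans)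
qed (rule that)

lemma poly_right_coord:
  assumes x: "poly x f" and l: "l \<in> \<Lambda>" "s \<in> T l" "t \<in> T l"
  shows "coord (a l s t * x) (l, s, t) = f (l, t)"
    and "j \<in> cell_index \<Lambda> T \<Longrightarrow> coord (a l s t * x) j \<noteq> 0 \<Longrightarrow> j \<noteq> (l, s, t) \<Longrightarrow> above (l, s, t) j"
proof -
  note R = right_action[OF l, of x]
  show "coord (a l s t * x) (l, s, t) = f (l, t)"
    using coord_cell[OF R l] poly_cell_matrix(1)[OF x l(1,3)] by simp
  assume j: "j \<in> cell_index \<Lambda> T" "coord (a l s t * x) j \<noteq> 0" "j \<noteq> (l, s, t)"
  obtain m u v where [simp]: "j = (m, u, v)" by (cases j)
  show "above (l, s, t) j"
    using coord_of_cell[OF R l(1,2), of m u v] j poly_cell_matrix(2)[OF x l(1,3), of v]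
    by (auto simp: above_def cell_index_def)
qed

lemma coord_star:
  assumes "(m, u, v) \<in> cell_index \<Lambda> T"
  shows "coord (star x) (m, u, v) = coord x (m, v, u)"
proof (rule coord_unique[OF _ assms, where y = "\<lambda>(m, u, v). coord x (m, v, u)", simplified])
  have "star x = (\<Sum>(l, s, t)\<in>cell_index \<Lambda> T. coord x (l, s, t) *s a l t s)"
    by (rule cell_star_coord[OF free_basis])
  also have "\<dots> = (\<Sum>(l, s, t)\<in>cell_index \<Lambda> T. coord x (l, t, s) *s a l s t)"
    by (rule sum.reindex_bij_witness[where i = "\<lambda>(l, s, t). (l, t, s)" and j = "\<lambda>(l, s, t). (l, t, s)"])
      (auto simp: cell_index_def)
  finally show "star x = (\<Sum>i\<in>cell_index \<Lambda> T. (case i of (m, u, v) \<Rightarrow> coord x (m, v, u)) *s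
      (case i of (l, s, t) \<Rightarrow> a l s t))"
    by (simp add: case_prod_beta)
qed

text \<open>The involution interchanges left and right multiplication and fixes polynomials.\<close>
lemma poly_left_coord:
  assumes x: "poly x f" and l: "l \<in> \<Lambda>" "s \<in> T l" "t \<in> T l"
  shows "coord (x * a l s t) (l, s, t) = f (l, s)"
    and "j \<in> cell_index \<Lambda> T \<Longrightarrow> coord (x * a l s t) j \<noteq> 0 \<Longrightarrow> j \<noteq> (l, s, t) \<Longrightarrow> above (l, s, t) j"
proof -
  have eq: "x * a l s t = star (a l t s * x)"
    using poly_star[OF x] l by (simp add: star_mult star_basis)
  have sw: "coord (x * a l s t) (m, u, v) = coord (a l t s * x) (m, v, u)"
    if "(m, u, v) \<in> cell_index \<Lambda> T" for m u v
    unfolding eq by (rule coord_star[OF that])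
  have "(l, s, t) \<in> cell_index \<Lambda> T" using l by (simp add: cell_index_def)
  from sw[OF this] show "coord (x * a l s t) (l, s, t) = f (l, s)"
    using poly_right_coord(1)[OF x l(1,3,2)] by simp
  assume j: "j \<in> cell_index \<Lambda> T" "coord (x * a l s t) j \<noteq> 0" "j \<noteq> (l, s, t)"
  obtain m u v where [simp]: "j = (m, u, v)" by (cases j)
  show "above (l, s, t) j"
    using poly_right_coord(2)[OF x l(1,3,2), of "(m, v, u)"] sw[of m u v] j
    by (auto simp: above_def cell_index_def)
qed

end

section \<open>A polynomial is determined by its values\<close>

text \<open>
  Different basis vectors \<open>a l s t\<close> and \<open>a m u v\<close> differ in their left or in their right label, and some
  \<open>L q\<close> separates these labels. Hence left or right multiplication by \<open>L q\<close> distinguishes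
  the two vectors, and left multiplication by \<open>x\<close> commutes with both multiplications.
\<close>
lemma jm_poly_eq_zero:
  fixes scale :: "'r::idom \<Rightarrow> 'a::ring \<Rightarrow> 'a"
  assumes "jucys_murphy scale e \<Lambda> T a tgt M L c" and sep: "jm_separates \<Lambda> T M c"
    and x: "jm_poly scale e M L c x f" and f0: "\<And>p. p \<in> Sigma \<Lambda> T \<Longrightarrow> f p = 0"
  shows "x = 0"
proof -
  interpret jucys_murphy scale e \<Lambda> T a tgt M L c by fact
  let ?I = "cell_index \<Lambda> T" and ?b = "\<lambda>(l, s, t). a l s t"
  obtain h :: "_ \<Rightarrow> nat" where h: "\<And>i j. i \<in> ?I \<Longrightarrow> j \<in> ?I \<Longrightarrow> above i j \<Longrightarrow> h i < h j"
    using obtain_height by blast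
  have mem: "l \<in> \<Lambda>" "s \<in> T l" "t \<in> T l" if "(l, s, t) \<in> ?I" for l s t
    using that by (simp_all add: cell_index_def)
  have "x * e = 0"
  proof (rule strictly_triangular_commuting_zero[OF free_basis, where Y = "\<lambda>z. x * z" and h = h])
    show "span (?b ` ?I) = UNIV" by (simp add: set_eq_iff)
    show "module_hom scale scale (\<lambda>z. x * z)" by (rule mult_left_hom)
  next
    fix i j assume i: "i \<in> ?I" and j: "j \<in> ?I" and nz: "coord (x * ?b i) j \<noteq> 0"
    obtain l s t where [simp]: "i = (l, s, t)" by (cases i)
    have "above i j"
      using nz poly_left_coord(1)[OF x mem[of l s t]] poly_left_coord(2)[OF x mem[of l s t], of j]
        f0[of "(l, s)"] mem[of l s t] i j
      by (cases "j = (l, s, t)") auto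
    then show "h i < h j" by (rule h[OF i j])
  next
    fix i j assume i: "i \<in> ?I" and j: "j \<in> ?I" and ne: "i \<noteq> j"
    obtain l s t m u v where [simp]: "i = (l, s, t)" "j = (m, u, v)" using prod_cases3 by metis
    note m = mem[OF i[simplified]] mem[OF j[simplified]]
    have "(l, s) \<noteq> (m, u) \<or> (l, t) \<noteq> (m, v)" using ne by auto
    then obtain q where q: "q \<in> {1..M}" "c (l, s) q \<noteq> c (m, u) q \<or> c (l, t) q \<noteq> c (m, v) q"
      using sep m unfolding jm_separates_def by blast
    note gen = jm_poly.gen[OF q(1), of scale e L c]
    let ?P = "\<lambda>X d. module_hom scale scale X \<and> (\<forall>z. X (x * z) = x * X z) \<and>
        (\<forall>i\<in>?I. coord (X (?b i)) i = d i) \<and>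
        (\<forall>i\<in>?I. \<forall>j\<in>?I. i \<noteq> j \<longrightarrow> coord (X (?b i)) j \<noteq> 0 \<longrightarrow> h i < h j)"
    have left: "?P (\<lambda>z. L q * z) (\<lambda>(l, s, t). c (l, s) q)"
    proof (intro conjI)
      show "module_hom scale scale (\<lambda>z. L q * z)" by (rule mult_left_hom)
      show "\<forall>z. L q * (x * z) = x * (L q * z)"
        using poly_commute_gen[OF x q(1)] by (metis mult.assoc)
      show "\<forall>i\<in>?I. coord (L q * ?b i) i = (\<lambda>(l, s, t). c (l, s) q) i"
        by (auto dest: mem intro!: poly_left_coord(1)[OF gen])
      show "\<forall>i\<in>?I. \<forall>j\<in>?I. i \<noteq> j \<longrightarrow> coord (L q * ?b i) j \<noteq> 0 \<longrightarrow> h i < h j"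
        by (clarify, rule h) (auto dest: mem intro!: poly_left_coord(2)[OF gen])
    qed
    have right: "?P (\<lambda>z. z * L q) (\<lambda>(l, s, t). c (l, t) q)"
    proof (intro conjI)
      show "module_hom scale scale (\<lambda>z. z * L q)" by (rule mult_right_hom)
      show "\<forall>z. x * z * L q = x * (z * L q)" by (simp add: mult.assoc)
      show "\<forall>i\<in>?I. coord (?b i * L q) i = (\<lambda>(l, s, t). c (l, t) q) i"
        by (auto dest: mem intro!: poly_right_coord(1)[OF gen])
      show "\<forall>i\<in>?I. \<forall>j\<in>?I. i \<noteq> j \<longrightarrow> coord (?b i * L q) j \<noteq> 0 \<longrightarrow> h i < h j"
        by (clarify, rule h) (auto dest: mem intro!: poly_right_coord(2)[OF gen])
    qed
    show "\<exists>X d. module_hom scale scale X \<and> (\<forall>z. X (x * z) = x * X z) \<and>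
        (\<forall>i\<in>?I. coord (X (?b i)) i = d i) \<and>
        (\<forall>i\<in>?I. \<forall>j\<in>?I. i \<noteq> j \<longrightarrow> coord (X (?b i)) j \<noteq> 0 \<longrightarrow> h i < h j) \<and> d i \<noteq> d j"
      using q(2)
    proof
      assume "c (l, s) q \<noteq> c (m, u) q"
      with left show ?thesis
        by (intro exI[of _ "\<lambda>z. L q * z"] exI[of _ "\<lambda>(l, s, t). c (l, s) q"]) simp
    next
      assume "c (l, t) q \<noteq> c (m, v) q"
      with right show ?thesis
        by (intro exI[of _ "\<lambda>z. z * L q"] exI[of _ "\<lambda>(l, s, t). c (l, t) q"]) simp
    qed
  qed
  then show ?thesis by simp
qed

lemma jm_poly_unique:
  fixes scale :: "'r::idom \<Rightarrow> 'a::ring \<Rightarrow> 'a"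
  assumes jm: "jucys_murphy scale e \<Lambda> T a tgt M L c" and sep: "jm_separates \<Lambda> T M c"
    and x: "jm_poly scale e M L c x f" and y: "jm_poly scale e M L c y g"
    and eq: "\<And>p. p \<in> Sigma \<Lambda> T \<Longrightarrow> f p = g p"
  shows "x = y"
  using jm_poly_eq_zero[OF jm sep jucys_murphy.poly_diff[OF jm x y]] eq by simp

section \<open>Twisting a cellular basis by polynomials\<close>

context jucys_murphy
begin

definition span_above :: "'l \<times> 't \<times> 't \<Rightarrow> 'a set" where
  "span_above j = span ((\<lambda>(l, s, t). a l s t) ` {i \<in> cell_index \<Lambda> T. above j i})"

lemma span_above_iff: "x \<in> span_above j \<longleftrightarrow> (\<forall>i\<in>cell_index \<Lambda> T. \<not> above j i \<longrightarrow> coord x i = 0)"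
  unfolding span_above_def by (subst span_subfamily_iff) auto

lemma subspace_span_above: "subspace (span_above j)"
  unfolding span_above_def by simp

lemma
  assumes x: "poly x f" and l: "l \<in> \<Lambda>" "s \<in> T l" "t \<in> T l"
  shows poly_right_span_above: "a l s t * x - f (l, t) *s a l s t \<in> span_above (l, s, t)"
    and poly_left_span_above: "x * a l s t - f (l, s) *s a l s t \<in> span_above (l, s, t)"
proof -
  have i: "(l, s, t) \<in> cell_index \<Lambda> T" using l by (simp add: cell_index_def)
  have fam_coord: "coord (a l s t) j = (if j = (l, s, t) then 1 else 0)"
    if "j \<in> cell_index \<Lambda> T" for j
    using coord_family[OF i that] by simp
  show "a l s t * x - f (l, t) *s a l s t \<in> span_above (l, s, t)"
    unfolding span_above_iff
  proof (intro ballI impI)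
    fix j assume "j \<in> cell_index \<Lambda> T" "\<not> above (l, s, t) j"
    then show "coord (a l s t * x - f (l, t) *s a l s t) j = 0"
      using poly_right_coord(1)[OF x l] poly_right_coord(2)[OF x l, of j]
      by (auto simp: coord_diff coord_scale fam_coord)
  qed
  show "x * a l s t - f (l, s) *s a l s t \<in> span_above (l, s, t)"
    unfolding span_above_iff
  proof (intro ballI impI)
    fix j assume "j \<in> cell_index \<Lambda> T" "\<not> above (l, s, t) j"
    then show "coord (x * a l s t - f (l, s) *s a l s t) j = 0"
      using poly_left_coord(1)[OF x l] poly_left_coord(2)[OF x l, of j]
      by (auto simp: coord_diff coord_scale fam_coord)
  qed
qed

lemma poly_span_above:
  assumes x: "poly x f" and j: "j \<in> cell_index \<Lambda> T" and z: "z \<in> span_above j"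
  shows "x * z \<in> span_above j"
proof -
  have "(\<lambda>(l, s, t). a l s t) ` {i \<in> cell_index \<Lambda> T. above j i} \<subseteq> {z. x * z \<in> span_above j}"
  proof clarify
    fix l s t assume i: "(l, s, t) \<in> cell_index \<Lambda> T" "above j (l, s, t)"
    then have l: "l \<in> \<Lambda>" "s \<in> T l" "t \<in> T l" by (simp_all add: cell_index_def)
    have "span_above (l, s, t) \<subseteq> span_above j"
      unfolding span_above_def using i(2) above_trans[OF j i(1)] by (intro span_mono image_mono) auto
    then have "x * a l s t - f (l, s) *s a l s t \<in> span_above j"
      using poly_left_span_above[OF x l] by blast
    moreover have "f (l, s) *s a l s t \<in> span_above j"
      unfolding span_above_def using i by (intro span_scale span_base) force
    ultimately have "(x * a l s t - f (l, s) *s a l s t) + f (l, s) *s a l s t \<in> span_above j"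
      by (rule subspace_add[OF subspace_span_above])
    then show "x * a l s t \<in> span_above j" by simp
  qed
  from span_minimal[OF this module_hom.subspace_linear_preimage[OF mult_left_hom subspace_span_above]] z
  show ?thesis by (auto simp: span_above_def)
qed

text \<open>
  In the cell module with basis \<open>a\<^sub>v\<close> the vectors \<open>a\<^sub>v * G v\<close> form another basis, because \<open>a\<^sub>v * G v\<close> is \<open>a\<^sub>v\<close> plus
  terms \<open>a\<^sub>u\<close> with \<open>u \<triangleright> v\<close>. What matters is that the coefficients \<open>q\<close> can be chosen independently of the row \<open>s\<close>, as the
  cellular axiom for the twisted basis demands this.
\<close>
lemma twist_cell_module_basis:
  assumes G: "\<And>t. t \<in> T l \<Longrightarrow> \<exists>f. poly (G t) f \<and> f (l, t) = 1" and l: "l \<in> \<Lambda>" and w: "w \<in> T l"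
  shows "\<exists>q. \<forall>s\<in>T l. a l s w - (\<Sum>v\<in>T l. q v *s (a l s v * G v)) \<in> higher l"
proof -
  obtain h :: "'t \<Rightarrow> nat" where h: "\<And>u v. u \<in> T l \<Longrightarrow> v \<in> T l \<Longrightarrow> tgt l v u \<Longrightarrow> h u < h v"
  proof (rule finite_strict_order_height[OF finite_tableaux[OF l], of "\<lambda>u v. tgt l v u"])
    show "irreflp_on (T l) (\<lambda>u v. tgt l v u)" using tgt_irrefl[OF l] by (auto simp: irreflp_on_def)
    show "transp_on (T l) (\<lambda>u v. tgt l v u)"
      using tgt_trans[OF l] by (intro transp_onI) blast
  qed (rule that)
  obtain n where n: "\<And>t. t \<in> T l \<Longrightarrow> h t \<le> n"
    using finite_tableaux[OF l] by (metis Max_ge finite_imageI imageI)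
  show ?thesis
    using w
  proof (induction "n - h w" arbitrary: w rule: less_induct)
    case less
    note w = less.prems
    define U where "U = {v \<in> T l. v \<noteq> w \<and> tgt l v w}"
    have "\<exists>q. \<forall>s\<in>T l. a l s v - (\<Sum>x\<in>T l. q x *s (a l s x * G x)) \<in> higher l" if "v \<in> U" for v
      using that h[of w v] n[of v] w unfolding U_def by (intro less.hyps) auto
    then have "\<forall>v\<in>U. \<exists>q. \<forall>s\<in>T l. a l s v - (\<Sum>x\<in>T l. q x *s (a l s x * G x)) \<in> higher l"
      by blast
    from bchoice[OF this] obtain q where "\<forall>v\<in>U. \<forall>s\<in>T l.
        a l s v - (\<Sum>x\<in>T l. q v x *s (a l s x * G x)) \<in> higher l" ..
    then have q: "a l s v - (\<Sum>x\<in>T l. q v x *s (a l s x * G x)) \<in> higher l"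
      if "v \<in> U" "s \<in> T l" for v s
      using that by simp
    obtain f where f: "poly (G w) f" "f (l, w) = 1" using G w by blast
    let ?N = "cell_matrix l (G w) w"
    have fin: "finite (T l)" by (rule finite_tableaux[OF l])
    have N: "(\<Sum>v\<in>T l. ?N v *s a l s v) = a l s w + (\<Sum>v\<in>U. ?N v *s a l s v)" for s
    proof -
      have "?N v = 0" if "v \<in> T l - {w} - U" for v
        using that by (intro poly_cell_matrix(2)[OF f(1) l w]) (auto simp: U_def)
      then have "(\<Sum>v\<in>T l - {w}. ?N v *s a l s v) = (\<Sum>v\<in>U. ?N v *s a l s v)"
        using fin by (intro sum.mono_neutral_right ballI) (simp_all, auto simp: U_def)
      then show ?thesis
        using w fin poly_cell_matrix(1)[OF f(1) l w] f(2) by (simp add: sum.remove)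
    qed
    (* solve the triangular formula for a_w * G w for a_w, and substitute q for the higher a_v *)
    define p where "p x = (if x = w then 1 else 0) - (\<Sum>v\<in>U. ?N v * q v x)" for x
    show ?case
    proof (intro exI ballI)
      fix s assume s: "s \<in> T l"
      let ?b = "\<lambda>x. a l s x * G x"
      have "(\<Sum>x\<in>T l. p x *s ?b x) =
          (\<Sum>x\<in>T l. (if x = w then ?b w else 0)) - (\<Sum>x\<in>T l. \<Sum>v\<in>U. (?N v * q v x) *s ?b x)"
        unfolding p_def scale_left_diff_distrib sum_subtractf scale_sum_left
        by (simp cong: if_cong add: if_distrib[of "\<lambda>r. r *s _"] sum.delta fin)
      also have "(\<Sum>x\<in>T l. \<Sum>v\<in>U. (?N v * q v x) *s ?b x) =
          (\<Sum>v\<in>U. ?N v *s (\<Sum>x\<in>T l. q v x *s ?b x))"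
        by (subst sum.swap) (simp add: scale_sum_right)
      finally have "a l s w - (\<Sum>x\<in>T l. p x *s ?b x) =
          - (a l s w * G w - (\<Sum>v\<in>T l. ?N v *s a l s v))
          - (\<Sum>v\<in>U. ?N v *s (a l s v - (\<Sum>x\<in>T l. q v x *s ?b x)))"
        using w fin by (simp add: N scale_right_diff_distrib sum_subtractf)
      also have "\<dots> \<in> higher l"
      proof (rule higher_simps(3)[OF subspace_neg[OF subspace_higher]])
        show "a l s w * G w - (\<Sum>v\<in>T l. ?N v *s a l s v) \<in> higher l"
          by (rule right_action[OF l s w])
        show "(\<Sum>v\<in>U. ?N v *s (a l s v - (\<Sum>x\<in>T l. q v x *s ?b x))) \<in> higher l"
          by (intro higher_simps(4) higher_simps(2) q s)
      qed
      finally show "a l s w - (\<Sum>v\<in>T l. p v *s (a l s v * G v)) \<in> higher l" .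
    qed
  qed
qed

text \<open>
  Unitriangularity makes \<open>g\<close> a basis with the same cell filtration as \<open>a\<close>; since the \<open>G\<close>s
  are fixed by the involution, it exchanges \<open>g l s t\<close> and \<open>g l t s\<close>. For the cellular axiom,
  \<open>G l t * x\<close> is first moved across \<open>a l s t\<close>, and then the result is rewritten in the twisted basis
  of the cell module.
\<close>
theorem cellular_basis_twist:
  assumes G: "\<And>l t. l \<in> \<Lambda> \<Longrightarrow> t \<in> T l \<Longrightarrow> \<exists>f. poly (G l t) f \<and> f (l, t) = 1"
    and g: "\<And>l s t. l \<in> \<Lambda> \<Longrightarrow> s \<in> T l \<Longrightarrow> t \<in> T l \<Longrightarrow> g l s t = G l s * a l s t * G l t"
  shows "cellular_basis scale UNIV e \<Lambda> T g"
proof -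
  let ?I = "cell_index \<Lambda> T" and ?b = "\<lambda>(l, s, t). a l s t" and ?g = "\<lambda>(l, s, t). g l s t"
  obtain h :: "'l \<times> 't \<times> 't \<Rightarrow> nat" where h: "\<And>i j. i \<in> ?I \<Longrightarrow> j \<in> ?I \<Longrightarrow> above i j \<Longrightarrow> h i < h j"
    using obtain_height by blast
  have tri: "?g j - ?b j \<in> span_above j" if j: "j \<in> ?I" for j
  proof -
    obtain l s t where [simp]: "j = (l, s, t)" by (cases j)
    have l: "l \<in> \<Lambda>" "s \<in> T l" "t \<in> T l" using j by (simp_all add: cell_index_def)
    obtain f f' where f: "poly (G l s) f" "f (l, s) = 1" and f': "poly (G l t) f'" "f' (l, t) = 1"
      using G l by blast
    have "G l s * (a l s t * G l t - f' (l, t) *s a l s t) + (G l s * a l s t - f (l, s) *s a l s t) \<in> span_above j"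
      using poly_right_span_above[OF f'(1) l] poly_left_span_above[OF f(1) l] poly_span_above[OF f(1) j]
      by (intro subspace_add[OF subspace_span_above]) simp_all
    then show ?thesis using f f' by (simp add: g l right_diff_distrib mult.assoc)
  qed
  have famg: "free_family scale ?I ?g"
  proof (rule free_family_unitriangular)
    fix j assume j: "j \<in> ?I"
    show "?g j - ?b j \<in> span (?b ` {i \<in> ?I. h j < h i})"
      by (rule subsetD[OF span_mono[OF image_mono] tri[OF j, unfolded span_above_def]]) (use h[OF j] in auto)
  qed
  have span_g: "span (?g ` U) = span (?b ` U)"
    if U: "U \<subseteq> ?I" "\<And>i j. j \<in> U \<Longrightarrow> i \<in> ?I \<Longrightarrow> above j i \<Longrightarrow> i \<in> U" for U
  proof (rule span_unitriangular[OF U(1)])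
    fix j assume j: "j \<in> U"
    then have jI: "j \<in> ?I" using U(1) by auto
    show "?g j - ?b j \<in> span (?b ` {i \<in> U. h j < h i})"
      by (rule subsetD[OF span_mono[OF image_mono] tri[OF jI, unfolded span_above_def]]) (use h[OF jI] U(2)[OF j] in auto)
  qed
  have higher_g: "cell_higher scale \<Lambda> T g l = higher l" for l
  proof -
    have "cell_higher scale \<Lambda> T g l = span (?g ` {(m, u, v) \<in> ?I. l < m})"
      unfolding cell_higher_def cell_index_def
      by (rule arg_cong[where f = span]) (auto simp: image_iff; force)
    also have "\<dots> = higher l"
      unfolding higher_eq by (rule span_g) (auto simp: above_def intro: less_trans)
    finally show ?thesis .
  qed
  have star: "cell_star scale \<Lambda> T g x = star x" for x
  proof (rule cell_star_eqI[OF famg star_hom])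
    show "x \<in> span (cell_basis_set \<Lambda> T g)"
      using span_g[OF order_refl] by (simp add: cell_basis_set_def)
    fix l s t assume l: "l \<in> \<Lambda>" "s \<in> T l" "t \<in> T l"
    have "star (G l s) = G l s" "star (G l t) = G l t" using G l poly_star by blast+
    then show "star (g l s t) = g l t s"
      using l by (simp add: g star_mult star_basis mult.assoc)
  qed
  show ?thesis
  proof (rule cellular_basisI[OF _ finite_shapes finite_tableaux famg])
    show "unital_algebra scale UNIV e" using cellular by (simp add: cellular_basis_def)
    show "span (cell_basis_set \<Lambda> T g) = UNIV"
      using span_g[OF order_refl] by (simp add: cell_basis_set_def set_eq_iff)
    show "cell_star scale \<Lambda> T g (x * y) = cell_star scale \<Lambda> T g y * cell_star scale \<Lambda> T g x" for x y
      by (simp add: star star_mult)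
  next
    fix x l t assume l: "l \<in> \<Lambda>" and t: "t \<in> T l"
    have "\<forall>w\<in>T l. \<exists>q. \<forall>s\<in>T l. a l s w - (\<Sum>v\<in>T l. q v *s (a l s v * G l v)) \<in> higher l"
      by (intro ballI twist_cell_module_basis[of l "G l"] G l)
    from bchoice[OF this] obtain q where "\<forall>w\<in>T l. \<forall>s\<in>T l.
        a l s w - (\<Sum>v\<in>T l. q w v *s (a l s v * G l v)) \<in> higher l" ..
    then have q: "a l s w - (\<Sum>v\<in>T l. q w v *s (a l s v * G l v)) \<in> higher l"
      if "w \<in> T l" "s \<in> T l" for w s
      using that by simp
    let ?r = "cell_matrix l (G l t * x) t"
    show "\<exists>r. \<forall>s\<in>T l. g l s t * x - (\<Sum>v\<in>T l. r v *s g l s v) \<in> cell_higher scale \<Lambda> T g l"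
    proof (intro exI ballI)
      fix s assume s: "s \<in> T l"
      have "G l s * (a l s t * (G l t * x) - (\<Sum>w\<in>T l. ?r w *s a l s w)) +
          (\<Sum>w\<in>T l. ?r w *s (G l s * (a l s w - (\<Sum>v\<in>T l. q w v *s (a l s v * G l v))))) \<in> higher l"
      proof (rule higher_simps(1))
        show "G l s * (a l s t * (G l t * x) - (\<Sum>w\<in>T l. ?r w *s a l s w)) \<in> higher l"
          by (intro higher_left_ideal right_action l s t)
        show "(\<Sum>w\<in>T l. ?r w *s (G l s * (a l s w - (\<Sum>v\<in>T l. q w v *s (a l s v * G l v))))) \<in> higher l"
          by (intro higher_simps(2,4) higher_left_ideal q s)
      qed
      also have "G l s * (a l s t * (G l t * x) - (\<Sum>w\<in>T l. ?r w *s a l s w)) +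
          (\<Sum>w\<in>T l. ?r w *s (G l s * (a l s w - (\<Sum>v\<in>T l. q w v *s (a l s v * G l v))))) =
          g l s t * x - (\<Sum>w\<in>T l. ?r w *s (\<Sum>v\<in>T l. q w v *s g l s v))"
        using s t l by (simp add: g right_diff_distrib sum_distrib_left scale_mult_right
          scale_right_diff_distrib sum_subtractf mult.assoc)
      also have "(\<Sum>w\<in>T l. ?r w *s (\<Sum>v\<in>T l. q w v *s g l s v)) =
          (\<Sum>v\<in>T l. (\<Sum>w\<in>T l. ?r w * q w v) *s g l s v)"
        by (simp add: scale_sum_right scale_sum_left) (rule sum.swap)
      finally show "g l s t * x - (\<Sum>v\<in>T l. (\<Sum>w\<in>T l. ?r w * q w v) *s g l s v)
          \<in> cell_higher scale \<Lambda> T g l"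
        by (simp add: higher_g)
    qed
  qed
qed

end

section \<open>Extension of scalars\<close>

lemma module_frag_cmul: "module frag_cmul"
  by unfold_locales (simp_all add: frag_cmul_distrib frag_cmul_distrib2)

locale scalar_extension = module scale
  for scale :: "'r::comm_ring_1 \<Rightarrow> 'a::ring \<Rightarrow> 'a" +
  fixes \<phi> :: "'r \<Rightarrow> 's::comm_ring_1" and scaleB :: "'s \<Rightarrow> 'b::ring \<Rightarrow> 'b"
    and tens :: "'a \<Rightarrow> 's \<Rightarrow> 'b"
  assumes extension: "is_scalar_extension scale \<phi> scaleB tens"
    and hom_add: "\<phi> (x + y) = \<phi> x + \<phi> y"
    and hom_mult: "\<phi> (x * y) = \<phi> x * \<phi> y"
    and hom_one: "\<phi> 1 = 1"
begin

sublocale B: module scaleB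
  using extension by (simp add: is_scalar_extension_def)

lemma tens_mult: "tens x s * tens y t = tens (x * y) (s * t)"
  and scaleB_tens: "scaleB t (tens x s) = tens x (t * s)"
  using extension by (simp_all add: is_scalar_extension_def)

lemma hom_zero: "\<phi> 0 = 0"
  using hom_add[of 0 0] by simp

lemma tensor_eval_add: "tensor_eval scaleB tens (x + y) = tensor_eval scaleB tens x + tensor_eval scaleB tens y"
  using setsum_keys_plus_distrib[of "\<lambda>p n. scaleB (of_int n) (tens (fst p) (snd p))" x y]
  by (simp add: tensor_eval_def case_prod_beta B.scale_left_distrib)

lemma tensor_eval_of: "tensor_eval scaleB tens (frag_of (x, s)) = tens x s"
  by (simp add: tensor_eval_def keys_frag_of)

lemma tensor_eval_diff: "tensor_eval scaleB tens (x - y) = tensor_eval scaleB tens x - tensor_eval scaleB tens y"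
  using tensor_eval_add[of "x - y" y] by simp

lemma tensor_eval_kernel:
  "tensor_eval scaleB tens z = 0 \<longleftrightarrow> z \<in> module.span frag_cmul (tensor_relations scale \<phi>)"
  using extension unfolding is_scalar_extension_def by blast

lemma tensor_eval_relation: "z \<in> tensor_relations scale \<phi> \<Longrightarrow> tensor_eval scaleB tens z = 0"
  unfolding tensor_eval_kernel by (rule module.span_base[OF module_frag_cmul])

lemma tens_add_left: "tens (x + y) s = tens x s + tens y s"
proof -
  have "frag_of (x + y, s) - frag_of (x, s) - frag_of (y, s) \<in> tensor_relations scale \<phi>"
    unfolding tensor_relations_def by blast
  from tensor_eval_relation[OF this, unfolded tensor_eval_diff tensor_eval_of] show ?thesis
    by (simp add: algebra_simps)
qed

lemma tens_scale: "tens (scale r x) s = tens x (\<phi> r * s)"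
proof -
  have "frag_of (scale r x, s) - frag_of (x, \<phi> r * s) \<in> tensor_relations scale \<phi>"
    unfolding tensor_relations_def by blast
  from tensor_eval_relation[OF this] show ?thesis
    by (simp add: tensor_eval_diff tensor_eval_of)
qed

definition extend :: "'a \<Rightarrow> 'b" where "extend x = tens x 1"

lemma extend_add: "extend (x + y) = extend x + extend y"
  by (simp add: extend_def tens_add_left)

lemma extend_scale: "extend (scale r x) = scaleB (\<phi> r) (extend x)"
  by (simp add: extend_def tens_scale scaleB_tens)

lemma extend_mult: "extend (x * y) = extend x * extend y"
  by (simp add: extend_def tens_mult)

lemma extend_zero: "extend 0 = 0"
  using extend_add[of 0 0] by simp

lemma extend_diff: "extend (x - y) = extend x - extend y"
  using extend_add[of "x - y" y] by simp

lemma extend_sum: "extend (sum f J) = (\<Sum>j\<in>J. extend (f j))"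
  by (induction J rule: infinite_finite_induct) (simp_all add: extend_zero extend_add)

lemma tens_eq: "tens x s = scaleB s (extend x)"
  by (simp add: extend_def scaleB_tens)

lemma subspace_extend_vimage: "B.subspace V \<Longrightarrow> subspace {x. extend x \<in> V}"
  by (rule subspaceI)
    (simp_all add: extend_zero extend_add extend_scale B.subspace_0 B.subspace_add B.subspace_scale)

lemma extend_induct:
  assumes V: "B.subspace V" and "\<And>x. extend x \<in> V"
  shows "y \<in> V"
proof -
  obtain z where "y = tensor_eval scaleB tens z"
    using extension unfolding is_scalar_extension_def by (metis surjD)
  then show ?thesis
    using assms by (auto simp: tensor_eval_def tens_eq intro!: B.subspace_sum B.subspace_scale)
qed

text \<open>
  A linear functional \<open>\<kappa>\<close> on \<open>A\<close> extends to the tensor product. The extension is defined on the free abelian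
  group, where it kills the defining relations; it is therefore well defined on
  elements, and in particular it vanishes on every expression that represents \<open>0\<close>.
\<close>
lemma tensor_functional:
  assumes \<kappa>: "\<And>x y. \<kappa> (x + y) = \<kappa> x + \<kappa> y" "\<And>r x. \<kappa> (scale r x) = r * \<kappa> x"
    and zero: "(\<Sum>j\<in>J. tens (x j) (y j)) = 0"
  shows "(\<Sum>j\<in>J. \<phi> (\<kappa> (x j)) * y j) = 0"
proof (cases "finite J")
  case fin: True
  define \<theta> where "\<theta> z = (\<Sum>p\<in>Poly_Mapping.keys z.
    of_int (Poly_Mapping.lookup z p) * (\<phi> (\<kappa> (fst p)) * snd p))" for z
  have add: "\<theta> (z + z') = \<theta> z + \<theta> z'" for z z'
    using setsum_keys_plus_distrib[of "\<lambda>p n. of_int n * (\<phi> (\<kappa> (fst p)) * snd p)" z z']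
    by (simp add: \<theta>_def distrib_right)
  have zero': "\<theta> 0 = 0" by (simp add: \<theta>_def)
  have of: "\<theta> (frag_of (x, s)) = \<phi> (\<kappa> x) * s" for x s
    by (simp add: \<theta>_def keys_frag_of)
  have diff: "\<theta> (z - z') = \<theta> z - \<theta> z'" for z z'
    using add[of "z - z'" z'] by simp
  have cmul: "\<theta> (frag_cmul n z) = of_int n * \<theta> z" for n z
    unfolding \<theta>_def sum_distrib_left
    by (cases "n = 0") (auto intro!: sum.cong simp: set_eq_iff mult.assoc)
  interpret F: module frag_cmul by (rule module_frag_cmul)
  have "tensor_relations scale \<phi> \<subseteq> {z. \<theta> z = 0}"
    unfolding tensor_relations_def
    by (auto simp: diff of \<kappa> hom_add hom_mult) (simp_all add: algebra_simps)
  moreover have "F.subspace {z. \<theta> z = 0}"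
    by (rule F.subspaceI) (simp_all add: zero' add cmul)
  ultimately have kernel: "F.span (tensor_relations scale \<phi>) \<subseteq> {z. \<theta> z = 0}"
    by (rule F.span_minimal)
  let ?z = "\<Sum>j\<in>J. frag_of (x j, y j)"
  have "tensor_eval scaleB tens ?z = (\<Sum>j\<in>J. tens (x j) (y j))" "\<theta> ?z = (\<Sum>j\<in>J. \<phi> (\<kappa> (x j)) * y j)"
    using fin tensor_eval_diff[of 0 0]
    by (induction J) (simp_all add: tensor_eval_add tensor_eval_of add of zero')
  then show ?thesis using zero kernel tensor_eval_kernel[of ?z] by auto
qed simp

end

locale cellular_extension = cellular_algebra scale e \<Lambda> T a + scalar_extension scale \<phi> scaleB tens
  for scale :: "'r::comm_ring_1 \<Rightarrow> 'a::ring \<Rightarrow> 'a" and e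
    and \<Lambda> :: "'l::order set" and T :: "'l \<Rightarrow> 't set" and a
    and \<phi> :: "'r \<Rightarrow> 's::comm_ring_1" and scaleB :: "'s \<Rightarrow> 'b::ring \<Rightarrow> 'b" and tens
begin

abbreviation aB :: "'l \<Rightarrow> 't \<Rightarrow> 't \<Rightarrow> 'b" where "aB l s t \<equiv> extend (a l s t)"

lemma extend_coords: "extend x = (\<Sum>j\<in>cell_index \<Lambda> T. scaleB (\<phi> (coord x j)) ((\<lambda>(l, s, t). aB l s t) j))"
proof -
  have "extend x = extend (\<Sum>j\<in>cell_index \<Lambda> T. scale (coord x j) ((\<lambda>(l, s, t). a l s t) j))"
    by (simp add: sum_coord)
  then show ?thesis by (simp add: extend_sum extend_scale case_prod_beta)
qed

lemma span_extended_basis: "B.span (cell_basis_set \<Lambda> T aB) = UNIV"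
proof -
  have "extend x \<in> B.span (cell_basis_set \<Lambda> T aB)" for x
    unfolding extend_coords[of x] cell_basis_set_def
    by (intro B.span_sum B.span_scale B.span_base imageI)
  then show ?thesis
    using extend_induct[OF B.subspace_span] by blast
qed

text \<open>The coordinate functionals, extended to the tensor product, detect all coefficients.\<close>
lemma free_extended_basis: "free_family scaleB (cell_index \<Lambda> T) (\<lambda>(l, s, t). aB l s t)"
proof (rule B.free_familyI[OF finite_index])
  fix y m assume sum: "(\<Sum>j\<in>cell_index \<Lambda> T. scaleB (y j) ((\<lambda>(l, s, t). aB l s t) j)) = 0"
    and m: "m \<in> cell_index \<Lambda> T"
  have "(\<Sum>j\<in>cell_index \<Lambda> T. tens ((\<lambda>(l, s, t). a l s t) j) (y j)) = 0"
    using sum by (simp add: tens_eq case_prod_beta)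
  then have "(\<Sum>j\<in>cell_index \<Lambda> T. \<phi> (coord ((\<lambda>(l, s, t). a l s t) j) m) * y j) = 0"
    using m by (intro tensor_functional[where \<kappa> = "\<lambda>x. coord x m"]) (simp_all add: coord_add coord_scale)
  also have "(\<Sum>j\<in>cell_index \<Lambda> T. \<phi> (coord ((\<lambda>(l, s, t). a l s t) j) m) * y j) =
      (\<Sum>j\<in>cell_index \<Lambda> T. if j = m then y m else 0)"
    using coord_family[OF _ m] by (intro sum.cong) (auto simp: hom_zero hom_one)
  also have "\<dots> = y m" using m finite_index by simp
  finally show "y m = 0" .
qed

lemma extend_eq_zero:
  assumes "\<And>r. \<phi> r = 0 \<Longrightarrow> r = 0" and "extend x = 0"
  shows "x = 0"
proof -
  interpret fB: free_family scaleB "cell_index \<Lambda> T" "\<lambda>(l, s, t). aB l s t"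
    by (rule free_extended_basis)
  have "coord x j = 0" if "j \<in> cell_index \<Lambda> T" for j
    using fB.sum_eq_zeroD[OF _ that, of "\<lambda>j. \<phi> (coord x j)"] extend_coords[of x] assms by simp
  then show ?thesis using sum_coord[of x] by simp
qed

lemma extend_higher: "x \<in> cell_higher scale \<Lambda> T a l \<Longrightarrow> extend x \<in> cell_higher scaleB \<Lambda> T aB l"
proof -
  have "cell_higher scale \<Lambda> T a l \<subseteq> {x. extend x \<in> cell_higher scaleB \<Lambda> T aB l}"
    by (rule higher_subset_subspace)
      (auto simp: cell_higher_def intro!: subspace_extend_vimage B.span_base)
  then show "x \<in> cell_higher scale \<Lambda> T a l \<Longrightarrow> extend x \<in> cell_higher scaleB \<Lambda> T aB l" by blast
qed

lemma extend_star: "cell_star scaleB \<Lambda> T aB (extend x) = extend (cell_star scale \<Lambda> T a x)"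
proof -
  note starB = cell_star_hom[OF free_extended_basis, unfolded span_extended_basis, simplified]
  have zero: "cell_star scaleB \<Lambda> T aB 0 = 0" using starB(2)[of 0 0] by simp
  show ?thesis
    by (rule basis_induct[of "{x. cell_star scaleB \<Lambda> T aB (extend x) = extend (star x)}", simplified])
      (auto intro!: subspaceI simp: starB star_basis star_add star_scale extend_add extend_scale
        extend_zero zero module_hom.zero[OF star_hom])
qed

text \<open>
  The action of scalars is prescribed on pure tensors only. Compatibility with products is obtained by
  extending first in the right factor, against an arbitrary pure tensor on the left, and then in
  the left factor.
\<close>
lemma scale_times:
  shows scale_times_left: "scaleB s y * z = scaleB s (y * z)"
    and scale_times_right: "y * scaleB s z = scaleB s (y * z)"
proof -
  have right: "tens x u * scaleB s z = scaleB s (tens x u * z)" for x u s z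
  proof -
    have "z \<in> {z. \<forall>s. tens x u * scaleB s z = scaleB s (tens x u * z)}"
    proof (rule extend_induct)
      show "B.subspace {z. \<forall>s. tens x u * scaleB s z = scaleB s (tens x u * z)}"
        by (rule B.subspaceI) (simp_all add: B.scale_right_distrib distrib_left)
    qed (simp add: extend_def scaleB_tens tens_mult mult_ac)
    then show ?thesis by simp
  qed
  have left: "tens x s * z = scaleB s (tens x 1 * z)" for x s z
  proof -
    have "z \<in> {z. tens x s * z = scaleB s (tens x 1 * z)}"
    proof (rule extend_induct)
      show "B.subspace {z. tens x s * z = scaleB s (tens x 1 * z)}"
        by (rule B.subspaceI) (simp_all add: B.scale_right_distrib distrib_left right mult.commute)
    qed (simp add: extend_def scaleB_tens tens_mult)
    then show ?thesis by simp
  qed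
  have "y \<in> {y. \<forall>s z. y * scaleB s z = scaleB s (y * z) \<and> scaleB s y * z = scaleB s (y * z)}"
  proof (rule extend_induct)
    show "B.subspace {y. \<forall>s z. y * scaleB s z = scaleB s (y * z) \<and> scaleB s y * z = scaleB s (y * z)}"
      by (rule B.subspaceI) (simp_all add: B.scale_right_distrib distrib_right mult.commute)
    fix x
    have "scaleB s (extend x) * z = scaleB s (extend x * z)" for s z
      unfolding extend_def scaleB_tens mult_1_right by (rule left)
    then show "extend x \<in> {y. \<forall>s z. y * scaleB s z = scaleB s (y * z) \<and> scaleB s y * z = scaleB s (y * z)}"
      by (simp add: extend_def right)
  qed
  then show "scaleB s y * z = scaleB s (y * z)" "y * scaleB s z = scaleB s (y * z)" by simp_all
qed

theorem cellular_basis_extension: "cellular_basis scaleB UNIV (extend e) \<Lambda> T aB"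
proof (rule cellular_basisI[OF _ finite_shapes finite_tableaux free_extended_basis span_extended_basis])
  show "unital_algebra scaleB UNIV (extend e)"
    unfolding unital_algebra_def
  proof (intro conjI ballI allI)
    show "module scaleB" by (rule B.module_axioms)
    fix x
    have "x \<in> {x. extend e * x = x \<and> x * extend e = x}"
      by (rule extend_induct, rule B.subspaceI)
        (simp_all add: distrib_left distrib_right scale_times extend_mult[symmetric])
    then show "extend e * x = x" "x * extend e = x" by simp_all
  qed (simp_all add: scale_times)
next
  fix y l t assume l: "l \<in> \<Lambda>" "t \<in> T l"
  let ?H = "cell_higher scaleB \<Lambda> T aB l"
  let ?V = "{y. \<exists>r. \<forall>s\<in>T l. aB l s t * y - (\<Sum>v\<in>T l. scaleB (r v) (aB l s v)) \<in> ?H}"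
  have H: "B.subspace ?H" by (simp add: cell_higher_def)
  have "y \<in> ?V"
  proof (rule extend_induct)
    show "B.subspace ?V"
    proof (rule B.subspaceI)
      show "0 \<in> ?V" using B.subspace_0[OF H] by (auto intro!: exI[of _ "\<lambda>_. 0"])
    next
      fix x y assume "x \<in> ?V" "y \<in> ?V"
      then obtain p q where
        p: "\<And>s. s \<in> T l \<Longrightarrow> aB l s t * x - (\<Sum>v\<in>T l. scaleB (p v) (aB l s v)) \<in> ?H" and
        q: "\<And>s. s \<in> T l \<Longrightarrow> aB l s t * y - (\<Sum>v\<in>T l. scaleB (q v) (aB l s v)) \<in> ?H" by blast
      have "aB l s t * (x + y) - (\<Sum>v\<in>T l. scaleB (p v + q v) (aB l s v)) \<in> ?H" if "s \<in> T l" for s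
        using B.subspace_add[OF H p[OF that] q[OF that]]
        unfolding distrib_left B.scale_left_distrib sum.distrib add_diff_add .
      then have "\<forall>s\<in>T l. aB l s t * (x + y) - (\<Sum>v\<in>T l. scaleB (p v + q v) (aB l s v)) \<in> ?H" ..
      then show "x + y \<in> ?V" by (intro CollectI exI[of _ "\<lambda>v. p v + q v"])
    next
      fix c x assume "x \<in> ?V"
      then obtain p where
        p: "\<And>s. s \<in> T l \<Longrightarrow> aB l s t * x - (\<Sum>v\<in>T l. scaleB (p v) (aB l s v)) \<in> ?H" by blast
      have "aB l s t * scaleB c x - (\<Sum>v\<in>T l. scaleB (c * p v) (aB l s v)) \<in> ?H" if "s \<in> T l" for s
        using B.subspace_scale[OF H p[OF that], of c]
        by (simp add: scale_times B.scale_right_diff_distrib B.scale_sum_right)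
      then have "\<forall>s\<in>T l. aB l s t * scaleB c x - (\<Sum>v\<in>T l. scaleB (c * p v) (aB l s v)) \<in> ?H" ..
      then show "scaleB c x \<in> ?V" by (intro CollectI exI[of _ "\<lambda>v. c * p v"])
    qed
    fix x
    have "aB l s t * extend x - (\<Sum>v\<in>T l. scaleB (\<phi> (cell_matrix l x t v)) (aB l s v)) \<in> ?H"
      if "s \<in> T l" for s
      using extend_higher[OF right_action[OF l(1) that l(2), of x]]
      by (simp add: extend_diff extend_mult extend_sum extend_scale)
    then have "\<forall>s\<in>T l. aB l s t * extend x -
        (\<Sum>v\<in>T l. scaleB (\<phi> (cell_matrix l x t v)) (aB l s v)) \<in> ?H" ..
    then show "extend x \<in> ?V" by (intro CollectI exI[of _ "\<lambda>v. \<phi> (cell_matrix l x t v)"])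
  qed
  then show "\<exists>r. \<forall>s\<in>T l. aB l s t * y - (\<Sum>v\<in>T l. scaleB (r v) (aB l s v)) \<in> ?H" by simp
next
  fix x y
  let ?star = "cell_star scaleB \<Lambda> T aB"
  note starB = cell_star_hom[OF free_extended_basis, unfolded span_extended_basis, simplified]
  have zero: "?star 0 = 0" using starB(2)[of 0 0] by simp
  have 1: "?star (x * extend y') = ?star (extend y') * ?star x" for y'
  proof -
    have "x \<in> {x. ?star (x * extend y') = ?star (extend y') * ?star x}"
      by (rule extend_induct, rule B.subspaceI)
        (simp_all add: zero starB distrib_left distrib_right scale_times extend_mult[symmetric]
          extend_star star_mult)
    then show ?thesis by simp
  qed
  have "y \<in> {y. ?star (x * y) = ?star y * ?star x}"
    by (rule extend_induct, rule B.subspaceI)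
      (simp_all add: zero starB distrib_left distrib_right scale_times 1)
  then show "?star (x * y) = ?star y * ?star x" by simp
qed

lemma jm_family_extension:
  assumes "jm_family scale \<Lambda> T tgt a M L c"
  shows "jm_family scaleB \<Lambda> T tgt aB M (\<lambda>i. extend (L i)) (\<lambda>p i. \<phi> (c p i))"
  unfolding jm_family_def
proof (intro conjI ballI)
  fix i assume i: "i \<in> {1..M}"
  show "extend (L i) * extend (L j) = extend (L j) * extend (L i)" if "j \<in> {1..M}" for j
    using assms i that by (simp add: jm_family_def flip: extend_mult)
  show "cell_star scaleB \<Lambda> T aB (extend (L i)) = extend (L i)"
    using assms i by (simp add: jm_family_def extend_star)
  fix l t assume l: "l \<in> \<Lambda>" "t \<in> T l"
  then obtain r where r: "\<And>s. s \<in> T l \<Longrightarrow> a l s t * L i -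
      (scale (c (l, t) i) (a l s t) + (\<Sum>v | v \<in> T l \<and> tgt l v t. scale (r v) (a l s v)))
      \<in> cell_higher scale \<Lambda> T a l"
    using assms i unfolding jm_family_def by blast
  show "\<exists>r. \<forall>s\<in>T l. aB l s t * extend (L i) - (scaleB (\<phi> (c (l, t) i)) (aB l s t) +
      (\<Sum>v | v \<in> T l \<and> tgt l v t. scaleB (r v) (aB l s v))) \<in> cell_higher scaleB \<Lambda> T aB l"
    using extend_higher[OF r]
    by (intro exI[of _ "\<lambda>v. \<phi> (r v)"])
      (simp add: extend_diff extend_add extend_mult extend_sum extend_scale)
qed

lemma jm_poly_extension:
  "jm_poly scale e M L c x f \<Longrightarrow>
   jm_poly scaleB (extend e) M (\<lambda>i. extend (L i)) (\<lambda>p i. \<phi> (c p i)) (extend x) (\<lambda>p. \<phi> (f p))"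
proof (induction rule: jm_poly.induct)
  case (gen i)
  from jm_poly.gen[OF this, of scaleB "extend e" "\<lambda>i. extend (L i)" "\<lambda>p i. \<phi> (c p i)"]
  show ?case .
qed (simp_all add: extend_scale extend_add extend_mult hom_add hom_mult jm_poly.intros)

end

section \<open>Discrete valuation rings and residue classes\<close>

text \<open>A non-unit lies in a maximal ideal by Zorn's lemma, and there is only one such ideal.\<close>
lemma (in dvr) unit_of_not_in_max_ideal:
  assumes "r \<notin> max_ideal"
  shows "r dvd 1"
proof (rule ccontr)
  assume not: "\<not> r dvd 1"
  define \<A> where "\<A> = {J. ring_ideal J \<and> r \<in> J \<and> 1 \<notin> J}"
  have "{x. r dvd x} \<in> \<A>"
    using not unfolding \<A>_def ring_ideal_def by (auto intro: dvd_add dvd_mult)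
  then have "\<A> \<noteq> {}" by blast
  have "\<Union>\<C> \<in> \<A>" if "\<C> \<noteq> {}" and chain: "subset.chain \<A> \<C>" for \<C>
  proof -
    have C: "\<C> \<subseteq> \<A>" using chain by (simp add: subset_chain_def)
    have "x + y \<in> \<Union>\<C>" if xy: "x \<in> \<Union>\<C>" "y \<in> \<Union>\<C>" for x y
    proof -
      obtain X Y where XY: "X \<in> \<C>" "x \<in> X" "Y \<in> \<C>" "y \<in> Y" using xy by blast
      then have "X \<subseteq> Y \<or> Y \<subseteq> X" using chain by (auto simp: subset_chain_def)
      then obtain Z where "Z \<in> \<C>" "x \<in> Z" "y \<in> Z" using XY by blast
      moreover from this C have "ring_ideal Z" by (auto simp: \<A>_def)
      ultimately have "x + y \<in> Z" by (simp add: ring_ideal_def)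
      then show ?thesis using \<open>Z \<in> \<C>\<close> by blast
    qed
    moreover have "s * x \<in> \<Union>\<C>" if x: "x \<in> \<Union>\<C>" for s x
    proof -
      obtain X where X: "X \<in> \<C>" "x \<in> X" using x by blast
      with C have "s * x \<in> X" by (auto simp: \<A>_def ring_ideal_def)
      with X(1) show ?thesis by blast
    qed
    moreover have "0 \<in> \<Union>\<C>" "r \<in> \<Union>\<C>" "1 \<notin> \<Union>\<C>"
      using C \<open>\<C> \<noteq> {}\<close> by (auto simp: \<A>_def ring_ideal_def)
    ultimately show ?thesis by (simp add: \<A>_def ring_ideal_def)
  qed
  from subset_Zorn_nonempty[OF \<open>\<A> \<noteq> {}\<close> this] obtain N
    where N: "N \<in> \<A>" and max: "\<And>J. J \<in> \<A> \<Longrightarrow> N \<subseteq> J \<Longrightarrow> J = N" by blast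
  have "J = UNIV" if "ring_ideal J" "1 \<in> J" for J
  proof -
    have "x * 1 \<in> J" for x using that unfolding ring_ideal_def by blast
    then show ?thesis by auto
  qed
  then have "ring_maximal_ideal N"
    using N max unfolding ring_maximal_ideal_def \<A>_def by blast
  then have "N = max_ideal" using max_ideal dvr_local by blast
  then show False using N assms by (simp add: \<A>_def)
qed

lemma residue_eq_zero_iff: "residue r = 0 \<longleftrightarrow> r \<in> max_ideal"
  by transfer (simp add: residue_rel_def)

lemma residue_add: "residue (x + y) = residue x + residue y"
  and residue_mult: "residue (x * y) = residue x * residue y"
  and residue_one: "residue 1 = 1"
  and residue_diff: "residue (x - y) = residue x - residue y"
  by (transfer; simp add: residue_rel_def max_ideal_closed)+

lemma residue_unit: "residue r \<noteq> 0 \<Longrightarrow> r dvd 1"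
  using unit_of_not_in_max_ideal by (auto simp: residue_eq_zero_iff)

context jucys_murphy
begin

lemma finite_pairs: "finite (Sigma \<Lambda> T)"
  using finite_shapes finite_tableaux by auto

lemma poly_commuting_prod:
  assumes "finite J" and x: "\<And>j. j \<in> J \<Longrightarrow> poly (x j) (f j)"
  shows "poly (commuting_prod e x J) (\<lambda>t. \<Prod>j\<in>J. f j t)"
proof -
  have comm: "comp_fun_commute_on J (\<lambda>i z. x i * z)"
  proof
    fix i j assume "i \<in> J" "j \<in> J"
    then have "x j * x i = x i * x j" by (intro poly_commute[OF x x])
    then show "(\<lambda>z. x j * z) \<circ> (\<lambda>z. x i * z) = (\<lambda>z. x i * z) \<circ> (\<lambda>z. x j * z)"
      by (simp add: fun_eq_iff flip: mult.assoc)
  qed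
  have "poly (commuting_prod e x J') (\<lambda>t. \<Prod>j\<in>J'. f j t)" if "finite J'" "J' \<subseteq> J" for J'
    using that
  proof (induction J')
    case empty
    then show ?case by (simp add: commuting_prod_def poly_unit)
  next
    case (insert j J')
    have "commuting_prod e x (insert j J') = x j * commuting_prod e x J'"
      unfolding commuting_prod_def
      using insert.hyps insert.prems by (intro comp_fun_commute_on.fold_insert[OF comm]) auto
    then show ?case
      using insert jm_poly.mult[OF x[of j]] by simp
  qed
  then show ?thesis using assms(1) by blast
qed

end

text \<open>
  Lagrange interpolation: at \<open>s \<noteq> t\<close> some content differs, and the corresponding factor vanishes.
\<close>
lemma poly_jm_F:
  fixes scale :: "'k::field \<Rightarrow> 'a::ring \<Rightarrow> 'a" and T :: "'l::order \<Rightarrow> 't set"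
  assumes "jucys_murphy scale e \<Lambda> T a tgt M L c" and sep: "jm_separates \<Lambda> T M c"
    and t: "t \<in> Sigma \<Lambda> T"
  obtains f where "jm_poly scale e M L c (jm_F scale e (Sigma \<Lambda> T) M L c t) f"
    and "\<And>s. s \<in> Sigma \<Lambda> T \<Longrightarrow> f s = (if s = t then 1 else 0)"
proof
  interpret jucys_murphy scale e \<Lambda> T a tgt M L c by fact
  let ?P = "Sigma \<Lambda> T"
  let ?J = "SIGMA i:{1..M}. (\<lambda>s. c s i) ` ?P - {c t i}"
  let ?f = "\<lambda>j s. (c s (fst j) - snd j) / (c t (fst j) - snd j)"
  have fin: "finite ?J" using finite_pairs by auto
  show "poly (jm_F scale e ?P M L c t) (\<lambda>s. \<Prod>j\<in>?J. ?f j s)"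
    unfolding jm_F_def
  proof (rule poly_commuting_prod[OF fin])
    fix j assume "j \<in> ?J"
    then obtain i d where [simp]: "j = (i, d)" and i: "i \<in> {1..M}" by auto
    have "poly (scale (1 / (c t i - d)) (L i - scale d e)) (\<lambda>s. 1 / (c t i - d) * (c s i - d))"
      by (intro poly_scale poly_diff jm_poly.gen jm_poly.const i)
    then show "poly (case j of (i, d) \<Rightarrow> scale (1 / (c t i - d)) (L i - scale d e)) (?f j)"
      by simp
  qed
  fix s assume s: "s \<in> ?P"
  show "(\<Prod>j\<in>?J. ?f j s) = (if s = t then 1 else 0)"
  proof (cases "s = t")
    case True
    then show ?thesis by (auto intro!: prod.neutral split: if_splits)
  next
    case False
    then obtain i where i: "i \<in> {1..M}" "c s i \<noteq> c t i"
      using sep s t unfolding jm_separates_def by blast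
    have J: "(i, c s i) \<in> ?J" using i s by auto
    have "(\<Prod>j\<in>?J. ?f j s) = 0"
      by (rule prod_zero[OF fin bexI[OF _ J]]) simp
    then show ?thesis using False by simp
  qed
qed

text \<open>
  The product \<open>h\<close> of all \<open>L i - d\<close>, where \<open>d\<close> runs through the contents whose residue is different from that of
  \<open>c p i\<close>, vanishes outside the residue class of \<open>p\<close>. On the class it need not be constant, but its values are
  units of \<open>R\<close>. If \<open>u r\<close> is the inverse of the value at \<open>r\<close>, the product of the \<open>1 - u r * h\<close> over the class is
  \<open>0\<close> on the class and \<open>1\<close> outside.
\<close>
lemma poly_residue_class_indicator:
  fixes scale :: "'r::dvr \<Rightarrow> 'a::ring \<Rightarrow> 'a" and T :: "'l::order \<Rightarrow> 't set"
  assumes "jucys_murphy scale e \<Lambda> T a tgt M L c" and p: "p \<in> Sigma \<Lambda> T"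
  obtains x f where "jm_poly scale e M L c x f"
    and "\<And>s. s \<in> Sigma \<Lambda> T \<Longrightarrow> f s = (if s \<in> residue_class (Sigma \<Lambda> T) M c p then 1 else 0)"
proof -
  interpret jucys_murphy scale e \<Lambda> T a tgt M L c by fact
  let ?P = "Sigma \<Lambda> T" and ?C = "residue_class (Sigma \<Lambda> T) M c p"
  let ?J = "SIGMA i:{1..M}. {d \<in> (\<lambda>s. c s i) ` ?P. residue d \<noteq> residue (c p i)}"
  define h where "h s = (\<Prod>j\<in>?J. c s (fst j) - snd j)" for s
  have "\<exists>x. poly x (\<lambda>s. c s (fst j) - snd j)" if "j \<in> ?J" for j
  proof
    have "fst j \<in> {1..M}" using that by auto
    then show "poly (L (fst j) - scale (snd j) e) (\<lambda>s. c s (fst j) - snd j)"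
      by (intro poly_diff jm_poly.gen jm_poly.const)
  qed
  from ex_poly_prod[OF this] obtain H where H: "poly H h" unfolding h_def[abs_def] ..
  have finJ: "finite ?J" using finite_pairs by auto
  have C: "?C \<subseteq> ?P" and finC: "finite ?C"
    using finite_pairs by (auto simp: residue_class_def)
  have h0: "h s = 0" if s: "s \<in> ?P" "s \<notin> ?C" for s
  proof -
    obtain i where i: "i \<in> {1..M}" "residue (c s i) \<noteq> residue (c p i)"
      using s unfolding residue_class_def by force
    have "(i, c s i) \<in> ?J" using i s by auto
    then show ?thesis
      unfolding h_def using finJ by (intro prod_zero) (auto intro!: bexI[of _ "(i, c s i)"])
  qed
  have "\<exists>u. u * h s = 1" if s: "s \<in> ?C" for s
  proof -
    have "c s i - d dvd 1" if "(i, d) \<in> ?J" for i d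
      using that s by (intro residue_unit) (auto simp: residue_diff residue_class_def)
    then have "h s dvd (\<Prod>j\<in>?J. 1)"
      unfolding h_def by (intro prod_dvd_prod) auto
    then show ?thesis by (auto simp: dvd_def mult.commute)
  qed
  then have "\<forall>s\<in>?C. \<exists>u. u * h s = 1" by blast
  from bchoice[OF this] obtain u where u: "\<forall>s\<in>?C. u s * h s = 1" ..
  have "\<exists>x. poly x (\<lambda>s. 1 - u r * h s)" for r
    using poly_diff[OF poly_unit poly_scale[OF H]] by blast
  from ex_poly_prod[OF this, where J = ?C]
  obtain y where y: "poly y (\<lambda>s. \<Prod>r\<in>?C. 1 - u r * h s)" ..
  show thesis
  proof
    show "poly (e - y) (\<lambda>s. 1 - (\<Prod>r\<in>?C. 1 - u r * h s))"
      by (rule poly_diff[OF poly_unit y])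
    fix s assume s: "s \<in> ?P"
    show "1 - (\<Prod>r\<in>?C. 1 - u r * h s) = (if s \<in> ?C then 1 else 0)"
    proof (cases "s \<in> ?C")
      case True
      then have "(\<Prod>r\<in>?C. 1 - u r * h s) = 0"
        using u finC by (intro prod_zero) auto
      then show ?thesis using True by simp
    qed (simp add: h0 s)
  qed
qed

lemma residue_class_eq_iff:
  assumes "q \<in> P"
  shows "residue_class P M c p = residue_class P M c q \<longleftrightarrow> q \<in> residue_class P M c p"
  using assms by (auto simp: residue_class_def)

lemma linkage_equiv: "equiv \<Lambda> ((linkage_step \<Lambda> T M c)\<^sup>* \<inter> \<Lambda> \<times> \<Lambda>)"
proof (rule equivI)
  have "sym (linkage_step \<Lambda> T M c)"
    unfolding linkage_step_def residue_class_def by (rule symI) (auto; metis)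
  then have "sym ((linkage_step \<Lambda> T M c)\<^sup>*)" by (rule sym_rtrancl)
  then show "sym ((linkage_step \<Lambda> T M c)\<^sup>* \<inter> \<Lambda> \<times> \<Lambda>)"
    by (auto simp: sym_def)
  show "refl_on \<Lambda> ((linkage_step \<Lambda> T M c)\<^sup>* \<inter> \<Lambda> \<times> \<Lambda>)"
    by (auto simp: refl_on_def)
  show "trans ((linkage_step \<Lambda> T M c)\<^sup>* \<inter> \<Lambda> \<times> \<Lambda>)"
    by (rule transI) (auto intro: rtrancl_trans)
qed auto

theorem theorem4p5:
  fixes scale :: "'r::dvr \<Rightarrow> 'a::ring \<Rightarrow> 'a"
    and scaleK :: "'r fract \<Rightarrow> 'aK::ring \<Rightarrow> 'aK"
    and scalek :: "'r residue_field \<Rightarrow> 'ak::ring \<Rightarrow> 'ak"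
    and tensK :: "'a \<Rightarrow> 'r fract \<Rightarrow> 'aK"
    and tensk :: "'a \<Rightarrow> 'r residue_field \<Rightarrow> 'ak"
    and one :: 'a
    and \<Lambda> :: "'l::order set"
    and T :: "'l \<Rightarrow> 't set"
    and tgt :: "'l \<Rightarrow> 't \<Rightarrow> 't \<Rightarrow> bool"
    and a :: "'l \<Rightarrow> 't \<Rightarrow> 't \<Rightarrow> 'a"
    and M :: nat
    and L :: "nat \<Rightarrow> 'a"
    and c :: "'l \<times> 't \<Rightarrow> nat \<Rightarrow> 'r"
  defines "g \<equiv> jm_g scaleK tensK tensk one \<Lambda> T a M L c"
  assumes cell: "cellular_basis scale UNIV one \<Lambda> T a"
    and order: "\<And>lam. lam \<in> \<Lambda> \<Longrightarrow> irreflp_on (T lam) (tgt lam) \<and> transp_on (T lam) (tgt lam)"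
    and jm: "jm_family scale \<Lambda> T tgt a M L c"
    and sep: "jm_separates \<Lambda> T M c"
    and A_K: "is_scalar_extension scale (\<lambda>r. Fract r 1) scaleK tensK"
    and A_k: "is_scalar_extension scale residue scalek tensk"
  shows "cellular_basis scalek UNIV (tensk one 1) \<Lambda> T g \<and>
    (\<forall>\<Gamma>\<in>linkage_classes \<Lambda> T M c.
       \<exists>e. cellular_basis scalek (linkage_component scalek T g \<Gamma>) e \<Gamma> T g) \<and>
    algebra_direct_sum UNIV (linkage_classes \<Lambda> T M c) (linkage_component scalek T g)"
proof -
  interpret R: jucys_murphy scale one \<Lambda> T a tgt M L c
    using cell order jm by unfold_locales
  interpret K: cellular_extension scale one \<Lambda> T a "\<lambda>r. Fract r 1" scaleK tensK
    using A_K by unfold_locales (simp_all add: One_fract_def)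
  interpret k: cellular_extension scale one \<Lambda> T a residue scalek tensk
    using A_k by unfold_locales (simp_all add: residue_add residue_mult residue_one)
  let ?P = "Sigma \<Lambda> T" and ?LK = "\<lambda>i. K.extend (L i)" and ?cK = "\<lambda>p i. Fract (c p i) 1"
  let ?C = "residue_class ?P M c"
  interpret KJ: jucys_murphy scaleK "K.extend one" \<Lambda> T K.aB tgt M ?LK ?cK
    using K.cellular_basis_extension order K.jm_family_extension[OF jm] by unfold_locales
  interpret kJ: jucys_murphy scalek "k.extend one" \<Lambda> T k.aB tgt M "\<lambda>i. k.extend (L i)" "\<lambda>p i. residue (c p i)"
    using k.cellular_basis_extension order k.jm_family_extension[OF jm] by unfold_locales
  have Fract_inj: "Fract x 1 = Fract y 1 \<longleftrightarrow> x = y" for x y :: 'r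
    by (simp add: eq_fract)
  have sepK: "jm_separates \<Lambda> T M ?cK"
    using sep by (simp add: jm_separates_def Fract_inj)

  have "\<forall>p\<in>?P. \<exists>x. \<exists>f. R.poly x f \<and> (\<forall>s\<in>?P. f s = (if s \<in> ?C p then 1 else 0))"
  proof
    fix p assume "p \<in> ?P"
    from poly_residue_class_indicator[OF R.jucys_murphy_axioms this] obtain x f
      where "R.poly x f" "\<And>s. s \<in> ?P \<Longrightarrow> f s = (if s \<in> ?C p then 1 else 0)" by blast
    then show "\<exists>x f. R.poly x f \<and> (\<forall>s\<in>?P. f s = (if s \<in> ?C p then 1 else 0))" by blast
  qed
  from bchoice[OF this] obtain E where
    "\<forall>p\<in>?P. \<exists>f. R.poly (E p) f \<and> (\<forall>s\<in>?P. f s = (if s \<in> ?C p then 1 else 0))" ..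
  from bchoice[OF this] obtain f where
    "\<forall>p\<in>?P. R.poly (E p) (f p) \<and> (\<forall>s\<in>?P. f p s = (if s \<in> ?C p then 1 else 0))" ..
  then have E: "\<And>p. p \<in> ?P \<Longrightarrow> R.poly (E p) (f p)"
    and f: "\<And>p s. p \<in> ?P \<Longrightarrow> s \<in> ?P \<Longrightarrow> f p s = (if s \<in> ?C p then 1 else 0)"
    by blast+

  (* different residue classes are disjoint, so all values of the product vanish *)
  have orth: "E p * E q = 0" if p: "p \<in> ?P" and q: "q \<in> ?P" and ne: "?C p \<noteq> ?C q" for p q
  proof (rule jm_poly_eq_zero[OF R.jucys_murphy_axioms sep jm_poly.mult[OF E[OF p] E[OF q]]])
    fix s assume s: "s \<in> ?P"
    have "s \<notin> ?C p \<or> s \<notin> ?C q"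
      using ne residue_class_eq_iff[OF s, of M c] by metis
    then show "f p s * f q s = 0" using f[OF p s] f[OF q s] by auto
  qed

  (* over K, both sides have the indicator function of the residue class as value function *)
  have F: "K.extend (E p) = (\<Sum>t\<in>?C p. jm_F scaleK (K.extend one) ?P M ?LK ?cK t)" (is "_ = sum ?F _")
    if p: "p \<in> ?P" for p
  proof -
    have "\<forall>t\<in>?P. \<exists>d. KJ.poly (?F t) d \<and> (\<forall>s\<in>?P. d s = (if s = t then 1 else 0))"
    proof
      fix t assume "t \<in> ?P"
      from poly_jm_F[OF KJ.jucys_murphy_axioms sepK this] obtain d
        where "KJ.poly (?F t) d" "\<And>s. s \<in> ?P \<Longrightarrow> d s = (if s = t then 1 else 0)" by blast
      then show "\<exists>d. KJ.poly (?F t) d \<and> (\<forall>s\<in>?P. d s = (if s = t then 1 else 0))" by blast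
    qed
    from bchoice[OF this] obtain d where
      "\<forall>t\<in>?P. KJ.poly (?F t) (d t) \<and> (\<forall>s\<in>?P. d t s = (if s = t then 1 else 0))" ..
    then have d: "\<And>t. t \<in> ?P \<Longrightarrow> KJ.poly (?F t) (d t)"
        "\<And>s t. t \<in> ?P \<Longrightarrow> s \<in> ?P \<Longrightarrow> d t s = (if s = t then 1 else 0)" by blast+
    have C: "?C p \<subseteq> ?P" by (auto simp: residue_class_def)
    then have finC: "finite (?C p)" using R.finite_pairs by (rule finite_subset)
    have sum: "KJ.poly (sum ?F (?C p)) (\<lambda>s. \<Sum>t\<in>?C p. d t s)"
      using C d(1) by (intro KJ.poly_sum) auto
    show ?thesis
    proof (rule jm_poly_unique[OF KJ.jucys_murphy_axioms sepK K.jm_poly_extension[OF E[OF p]] sum])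
      fix s assume s: "s \<in> ?P"
      have "(\<Sum>t\<in>?C p. d t s) = (\<Sum>t\<in>?C p. if t = s then 1 else 0)"
      proof (rule sum.cong[OF refl])
        fix t assume "t \<in> ?C p"
        with C have "t \<in> ?P" by (rule subsetD)
        from d(2)[OF this s] show "d t s = (if t = s then 1 else 0)" by (cases "t = s") simp_all
      qed
      then show "Fract (f p s) 1 = (\<Sum>t\<in>?C p. d t s)"
        using finC by (simp add: f[OF p s] One_fract_def Zero_fract_def)
    qed
  qed
  (* A embeds into its extension to K, so the definite description in jm_G denotes E p *)
  have "jm_G scaleK tensK tensk one ?P M L c (?C p) = k.extend (E p)" if p: "p \<in> ?P" for p
  proof -
    have "x = y" if "K.extend x = K.extend y" for x y
      using K.extend_eq_zero[of "x - y"] that by (simp add: K.extend_diff Zero_fract_def Fract_inj)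
    then have "(THE y. K.extend y = K.extend (E p)) = E p" by blast
    then show ?thesis
      unfolding jm_G_def using F[OF p] by (simp add: K.extend_def k.extend_def)
  qed
  then have g: "g l s t = k.extend (E (l, s)) * k.extend (a l s t) * k.extend (E (l, t))"
    if "l \<in> \<Lambda>" "s \<in> T l" "t \<in> T l" for l s t
    using that by (simp add: g_def jm_g_def Let_def k.extend_def)

  have g_cellular: "cellular_basis scalek UNIV (k.extend one) \<Lambda> T g"
  proof (rule kJ.cellular_basis_twist[where G = "\<lambda>l t. k.extend (E (l, t))"])
    fix l t assume "l \<in> \<Lambda>" "t \<in> T l"
    then have p: "(l, t) \<in> ?P" by simp
    have "f (l, t) (l, t) = 1" using f[OF p p] p by (simp add: residue_class_def)
    then show "\<exists>d. kJ.poly (k.extend (E (l, t))) d \<and> d (l, t) = 1"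
      using k.jm_poly_extension[OF E[OF p]] by (auto simp: residue_one)
  qed (rule g)

  let ?\<P> = "linkage_classes \<Lambda> T M c"
  have cover: "\<Union>?\<P> = \<Lambda>"
    unfolding linkage_classes_def by (rule Union_quotient[OF linkage_equiv])
  have disjoint: "\<Gamma> \<inter> \<Gamma>' = {}" if "\<Gamma> \<in> ?\<P>" "\<Gamma>' \<in> ?\<P>" "\<Gamma> \<noteq> \<Gamma>'" for \<Gamma> \<Gamma>'
    using that quotient_disj[OF linkage_equiv] unfolding linkage_classes_def by blast
  have annihilate: "g l s t * g m u v = 0"
    if \<Gamma>: "\<Gamma> \<in> ?\<P>" "\<Gamma>' \<in> ?\<P>" "\<Gamma> \<noteq> \<Gamma>'" "l \<in> \<Gamma>" "m \<in> \<Gamma>'"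
      and T: "s \<in> T l" "t \<in> T l" "u \<in> T m" "v \<in> T m" for \<Gamma> \<Gamma>' l m s t u v
  proof -
    have l: "l \<in> \<Lambda>" and m: "m \<in> \<Lambda>" using \<Gamma> cover by auto
    then have P: "(l, t) \<in> ?P" "(m, u) \<in> ?P" using T by auto
    have "?C (l, t) \<noteq> ?C (m, u)"
    proof
      assume "?C (l, t) = ?C (m, u)"
      then have "(l, m) \<in> linkage_step \<Lambda> T M c"
        using l m T residue_class_eq_iff[OF P(2)] unfolding linkage_step_def by blast
      then have "\<Gamma> = \<Gamma>'"
        using \<Gamma> l m by (intro quotient_eqI[OF linkage_equiv, of \<Gamma> \<Lambda> T M c \<Gamma>' l m])
          (auto simp: linkage_classes_def)
      then show False using \<Gamma>(3) by simp
    qed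
    then have "k.extend (E (l, t)) * k.extend (E (m, u)) = 0"
      using orth[OF P] by (simp add: k.extend_zero flip: k.extend_mult)
    then have "k.extend (E (l, t)) * (k.extend (E (m, u)) * z) = 0" for z
      by (simp flip: mult.assoc)
    then show ?thesis using l m T by (simp add: g mult.assoc)
  qed
  interpret kg: cellular_blocks scalek "k.extend one" \<Lambda> T g ?\<P>
    using g_cellular cover disjoint annihilate by unfold_locales
  show ?thesis
    using g_cellular kg.block_cellular kg.block_direct_sum by (simp add: k.extend_def)
qed

end
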